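(* Let $\mathcal{D}^*$ be a fixed, known distribution over $[N]$. There is an algorithm which, given $\varepsilon\in(0,1)$ and access to the \textsc{Samp} and \textsc{Pcond} oracles of an arbitrary distribution $\mathcal{D}$ over $[N]$, makes $\tilde{O}(\sqrt{\log N}\cdot\varepsilon^{-2})$ queries and satisfies: if $\mathcal{D}=\mathcal{D}^*$ it outputs ACCEPT with probability at least $2/3$, and if $d_{\mathrm{TV}}(\mathcal{D},\mathcal{D}^* )\ge\varepsilon$ it outputs REJECT with probability at least $2/3$.
   Context: For a distribution $\mathcal{D}$ over $[N]$ write $D(i)=\Pr_{x\sim\mathcal{D}}(x=i)$. \textsc{Samp} returns an independent sample from $\mathcal{D}$; \textsc{Pcond}$(x,y)$ for distinct $x,y\in[N]$ returns $x$ with probability $\frac{D(x)}{D(x)+D(y)}$ and $y$ otherwise, independently of previous calls. $d_{\mathrm{TV}}(\mathcal{D}_1,\mathcal{D}_2)=\frac12\sum_i|D_1(i)-D_2(i)|$. $\tilde O(\cdot)$ hides factors polylogarithmic in $1/\varepsilon$ and $\log N$. *)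

theory Defs
  imports "HOL-Probability.Probability"
begin

datatype verdict = Accept | Reject

text \<open>
  A randomized adaptive algorithm in the query model is a tree: each query node continues
  according to the received answer, and \<open>Rand\<close> nodes are internal randomness, which is not
  charged as a query.
\<close>

datatype tester =
    Output verdict
  | Samp "nat \<Rightarrow> tester"
  | Pcond nat nat "nat \<Rightarrow> tester"
  | Rand "nat pmf" "nat \<Rightarrow> tester"

definition distribution_on :: "nat \<Rightarrow> nat pmf \<Rightarrow> bool" where
  "distribution_on N D \<longleftrightarrow> set_pmf D \<subseteq> {1..N}"

definition d_TV :: "nat \<Rightarrow> nat pmf \<Rightarrow> nat pmf \<Rightarrow> real" where
  "d_TV N D1 D2 = (\<Sum>i\<in>{1..N}. \<bar>pmf D1 i - pmf D2 i\<bar>) / 2"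

text \<open>
  \<open>P x y\<close> is the law of the answer to the pair query \<open>(x, y)\<close>. When both points have mass zero the
  defining quotient is \<open>0 / 0\<close>; then the answer may follow any law on \<open>{x, y}\<close>.
\<close>

definition pcond_for :: "nat \<Rightarrow> nat pmf \<Rightarrow> (nat \<Rightarrow> nat \<Rightarrow> nat pmf) \<Rightarrow> bool" where
  "pcond_for N D P \<longleftrightarrow>
     (\<forall>x\<in>{1..N}. \<forall>y\<in>{1..N}. x \<noteq> y \<longrightarrow>
        set_pmf (P x y) \<subseteq> {x, y} \<and>
        (pmf D x + pmf D y > 0 \<longrightarrow> pmf (P x y) x = pmf D x / (pmf D x + pmf D y)))"

text \<open>Every query draws afresh, so answers are independent of the previous calls.\<close>

primrec run :: "nat pmf \<Rightarrow> (nat \<Rightarrow> nat \<Rightarrow> nat pmf) \<Rightarrow> tester \<Rightarrow> verdict pmf" where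
  "run D P (Output v) = return_pmf v"
| "run D P (Samp k) = bind_pmf D (\<lambda>i. run D P (k i))"
| "run D P (Pcond x y k) = bind_pmf (P x y) (\<lambda>i. run D P (k i))"
| "run D P (Rand R k) = bind_pmf R (\<lambda>r. run D P (k r))"

text \<open>
  Only branches that can occur are inspected: samples lie in \<open>{1..N}\<close>, pair answers in \<open>{x, y}\<close>.
\<close>

primrec legal_queries :: "nat \<Rightarrow> tester \<Rightarrow> bool" where
  "legal_queries N (Output v) \<longleftrightarrow> True"
| "legal_queries N (Samp k) \<longleftrightarrow> (\<forall>i\<in>{1..N}. legal_queries N (k i))"
| "legal_queries N (Pcond x y k) \<longleftrightarrow>
     x \<in> {1..N} \<and> y \<in> {1..N} \<and> x \<noteq> y \<and> (\<forall>i\<in>{x, y}. legal_queries N (k i))"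
| "legal_queries N (Rand R k) \<longleftrightarrow> (\<forall>r\<in>set_pmf R. legal_queries N (k r))"

text \<open>\<open>queries_le N t q\<close>: every execution of \<open>t\<close> makes at most \<open>q\<close> queries.\<close>

primrec queries_le :: "nat \<Rightarrow> tester \<Rightarrow> nat \<Rightarrow> bool" where
  "queries_le N (Output v) q \<longleftrightarrow> True"
| "queries_le N (Samp k) q \<longleftrightarrow> q > 0 \<and> (\<forall>i\<in>{1..N}. queries_le N (k i) (q - 1))"
| "queries_le N (Pcond x y k) q \<longleftrightarrow> q > 0 \<and> (\<forall>i\<in>{x, y}. queries_le N (k i) (q - 1))"
| "queries_le N (Rand R k) q \<longleftrightarrow> (\<forall>r\<in>set_pmf R. queries_le N (k r) q)"

text \<open>
  The factor hidden by the soft-O notation, polylogarithmic in \<open>1 / \<epsilon>\<close> and \<open>log N\<close>. The added ones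
  keep both logarithmic factors at least 1 for \<open>N \<ge> 1\<close> and \<open>0 < \<epsilon> < 1\<close>, so that the bound stays
  meaningful for \<open>\<epsilon>\<close> close to 1 and for small \<open>N\<close>.
\<close>

definition polylog_factor :: "nat \<Rightarrow> real \<Rightarrow> nat \<Rightarrow> real" where
  "polylog_factor c \<epsilon> N = (1 + ln (1 / \<epsilon>)) ^ c * (1 + ln (1 + ln (real N))) ^ c"

end

theory Submission
  imports Defs
begin

text \<open>
  Group the points into buckets on which \<open>Dstar\<close> varies by at most a factor 2, with one extra bucket
  for the points of mass at most \<open>\<epsilon> / (8 N)\<close>. There are only \<open>B = O(log (N / \<epsilon>))\<close> buckets, so a
  \<open>\<chi>\<^sup>2\<close>-type identity test on bucket weights needs \<open>O(\<surd>B / \<epsilon>\<^sup>2)\<close> samples. If the bucket weights are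
  nearly right but \<open>D\<close> is far from \<open>Dstar\<close>, then for \<open>x\<close> drawn from \<open>D\<close> and \<open>y\<close> drawn from \<open>Dstar\<close>
  restricted to the bucket of \<open>x\<close>, the answer probability of the pair query \<open>(x, y)\<close> differs from the
  expected one by \<open>\<Omega>(\<epsilon>)\<close> on average. Hence, up to a logarithmic factor, at some dyadic scale \<open>2\<^sup>-\<^sup>k\<close> a
  fraction \<open>2\<^sup>k \<epsilon>\<close> of the pairs has a gap of at least \<open>2\<^sup>-\<^sup>k\<close>; such a gap is visible after about \<open>4\<^sup>k\<close>
  queries, so examining about \<open>2\<^sup>-\<^sup>k / \<epsilon>\<close> pairs at each scale costs \<open>O(\<epsilon>\<^sup>-\<^sup>2)\<close> queries, again up to
  logarithmic factors.
\<close>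

abbreviation (input) accept_prob :: "nat pmf \<Rightarrow> (nat \<Rightarrow> nat \<Rightarrow> nat pmf) \<Rightarrow> tester \<Rightarrow> real" where
  "accept_prob D P t \<equiv> pmf (run D P t) Accept"

lemma pmf_Reject: "pmf p Reject = 1 - pmf p Accept"
proof -
  have "(\<Sum>v\<in>{Accept, Reject}. pmf p v) = 1"
    by (rule sum_pmf_eq_1) (auto intro: verdict.exhaust)
  then show ?thesis by simp
qed

lemma pmf_bind_finite:
  assumes "finite A" "set_pmf D \<subseteq> A"
  shows "pmf (bind_pmf D f) v = (\<Sum>i\<in>A. pmf D i * pmf (f i) v)"
  using assms by (simp add: pmf_bind integral_measure_pmf[of A] subset_iff)

subsection \<open>Combining testers\<close>

text \<open>Grafting \<open>u\<close> onto every accepting leaf of \<open>t\<close> runs it with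
  fresh randomness and fresh oracle answers, so acceptance probabilities multiply; a rejection ends
  the run at once.\<close>

primrec conj_tester :: "tester \<Rightarrow> tester \<Rightarrow> tester" where
  "conj_tester (Output v) u = (if v = Accept then u else Output Reject)"
| "conj_tester (Samp k) u = Samp (\<lambda>i. conj_tester (k i) u)"
| "conj_tester (Pcond x y k) u = Pcond x y (\<lambda>i. conj_tester (k i) u)"
| "conj_tester (Rand R k) u = Rand R (\<lambda>i. conj_tester (k i) u)"

lemma run_conj_tester:
  "run D P (conj_tester t u) =
     bind_pmf (run D P t) (\<lambda>v. if v = Accept then run D P u else return_pmf Reject)"
  by (induction t) (simp_all add: bind_return_pmf bind_assoc_pmf)

lemma accept_prob_conj_tester:
  "accept_prob D P (conj_tester t u) = accept_prob D P t * accept_prob D P u"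
  by (simp add: run_conj_tester pmf_bind_finite[of "{Accept, Reject}"] verdict.nchotomy subset_iff)

lemma legal_queries_conj_tester:
  "legal_queries N t \<Longrightarrow> legal_queries N u \<Longrightarrow> legal_queries N (conj_tester t u)"
  by (induction t) auto

lemma queries_le_mono: "queries_le N t q \<Longrightarrow> q \<le> q' \<Longrightarrow> queries_le N t q'"
proof (induction t arbitrary: q q')
  case (Samp k)
  have "queries_le N (k i) (q' - 1)" if "i \<in> {1..N}" for i
    using Samp.IH[of "k i" "q - 1" "q' - 1"] Samp.prems that by simp
  with Samp.prems show ?case by auto
next
  case (Pcond x y k)
  have "queries_le N (k i) (q' - 1)" if "i \<in> {x, y}" for i
    using Pcond.IH[of "k i" "q - 1" "q' - 1"] Pcond.prems that by auto
  with Pcond.prems show ?case by auto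
qed auto

lemma queries_le_conj_tester:
  "queries_le N t q \<Longrightarrow> queries_le N u r \<Longrightarrow> queries_le N (conj_tester t u) (q + r)"
proof (induction t arbitrary: q)
  case (Output v)
  then show ?case by (auto intro: queries_le_mono)
next
  case (Samp k)
  have "queries_le N (conj_tester (k i) u) ((q - 1) + r)" if "i \<in> {1..N}" for i
    using Samp.IH[of "k i" "q - 1"] Samp.prems that by simp
  with Samp.prems(1) show ?case by simp
next
  case (Pcond x y k)
  have "queries_le N (conj_tester (k i) u) ((q - 1) + r)" if "i \<in> {x, y}" for i
    using Pcond.IH[of "k i" "q - 1"] Pcond.prems that by auto
  with Pcond.prems(1) show ?case by simp
qed auto

definition all_testers :: "tester list \<Rightarrow> tester" where
  "all_testers ts = foldr conj_tester ts (Output Accept)"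

lemma all_testers_simps [simp]:
  "all_testers [] = Output Accept"
  "all_testers (t # ts) = conj_tester t (all_testers ts)"
  by (simp_all add: all_testers_def)

lemma legal_queries_all_testers:
  "(\<And>t. t \<in> set ts \<Longrightarrow> legal_queries N t) \<Longrightarrow> legal_queries N (all_testers ts)"
  by (induction ts) (auto intro: legal_queries_conj_tester)

lemma queries_le_all_testers:
  "(\<And>t. t \<in> set ts \<Longrightarrow> queries_le N t q) \<Longrightarrow> queries_le N (all_testers ts) (length ts * q)"
  by (induction ts) (auto intro: queries_le_conj_tester)

lemma accept_prob_all_testers_replicate:
  "accept_prob D P (all_testers (replicate n t)) = accept_prob D P t ^ n"
  by (induction n) (simp_all add: accept_prob_conj_tester)

lemma accept_prob_all_testers_le:
  "t \<in> set ts \<Longrightarrow> accept_prob D P (all_testers ts) \<le> accept_prob D P t"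
proof (induction ts)
  case (Cons s ts)
  have "accept_prob D P s * accept_prob D P (all_testers ts) \<le> accept_prob D P s"
    by (simp add: mult_left_le pmf_le_1)
  moreover have "accept_prob D P s * accept_prob D P (all_testers ts)
      \<le> accept_prob D P (all_testers ts)"
    by (simp add: mult_left_le_one_le pmf_le_1)
  ultimately show ?case
    using Cons by (auto simp: accept_prob_conj_tester)
qed simp

text \<open>A union bound over the rejections: each induction step uses ab \<ge> a + b - 1, that is,
  (1 - a)(1 - b) \<ge> 0.\<close>

lemma accept_prob_all_testers_ge:
  fixes \<delta> :: real
  assumes "\<And>t. t \<in> set ts \<Longrightarrow> accept_prob D P t \<ge> 1 - \<delta>"
  shows "accept_prob D P (all_testers ts) \<ge> 1 - length ts * \<delta>"
  using assms
proof (induction ts)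
  case (Cons t ts)
  let ?a = "accept_prob D P t" and ?b = "accept_prob D P (all_testers ts)"
  have "0 \<le> (1 - ?a) * (1 - ?b)"
    by (simp add: pmf_le_1)
  then have "?a * ?b \<ge> ?a + ?b - 1"
    by (simp add: algebra_simps)
  moreover have "?a \<ge> 1 - \<delta>" "?b \<ge> 1 - length ts * \<delta>"
    using Cons by auto
  ultimately show ?case
    by (simp add: accept_prob_conj_tester algebra_simps)
qed simp

section \<open>Batches of samples and of repeated pair queries\<close>

text \<open>Trees return only verdicts, so a batch of queries hands its answers to a
  continuation.\<close>

primrec draw_samples :: "nat \<Rightarrow> (nat list \<Rightarrow> tester) \<Rightarrow> tester" where
  "draw_samples 0 k = k []"
| "draw_samples (Suc n) k = Samp (\<lambda>i. draw_samples n (\<lambda>xs. k (i # xs)))"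

lemma run_draw_samples:
  "run D P (draw_samples n k) = bind_pmf (replicate_pmf n D) (\<lambda>xs. run D P (k xs))"
  by (induction n arbitrary: k) (simp_all add: bind_return_pmf bind_assoc_pmf)

lemma legal_queries_draw_samples:
  "(\<And>xs. legal_queries N (k xs)) \<Longrightarrow> legal_queries N (draw_samples n k)"
  by (induction n arbitrary: k) auto

lemma queries_le_draw_samples:
  "(\<And>xs. queries_le N (k xs) q) \<Longrightarrow> queries_le N (draw_samples n k) (n + q)"
  by (induction n arbitrary: k) auto

primrec count_pcond :: "nat \<Rightarrow> nat \<Rightarrow> nat \<Rightarrow> (nat \<Rightarrow> tester) \<Rightarrow> tester" where
  "count_pcond 0 x y k = k 0"
| "count_pcond (Suc n) x y k =
     Pcond x y (\<lambda>i. count_pcond n x y (\<lambda>c. k ((if i = x then 1 else 0) + c)))"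

text \<open>Whether a fresh answer equals \<open>x\<close> is a Bernoulli variable, so the number of
  such answers among \<open>n\<close> is binomial.\<close>

lemma run_count_pcond:
  "run D P (count_pcond n x y k) =
     bind_pmf (binomial_pmf n (pmf (P x y) x)) (\<lambda>c. run D P (k c))"
proof (induction n arbitrary: k)
  case 0
  then show ?case by (simp add: binomial_pmf_0 pmf_le_1 bind_return_pmf)
next
  case (Suc n)
  have *: "map_pmf (\<lambda>i. i = x) (P x y) = bernoulli_pmf (pmf (P x y) x)"
  proof (rule pmf_eqI)
    fix b
    have "(\<lambda>i. i = x) -` {True} = {x}" "(\<lambda>i. i = x) -` {False} = - {x}"
      by auto
    then show "pmf (map_pmf (\<lambda>i. i = x) (P x y)) b = pmf (bernoulli_pmf (pmf (P x y) x)) b"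
      using measure_pmf.prob_compl[of "{x}" "P x y"]
      by (cases b) (simp_all add: pmf_map measure_pmf_single pmf_le_1 Compl_eq_Diff_UNIV)
  qed
  show ?case
    by (simp add: Suc binomial_pmf_Suc pmf_le_1 flip: *)
       (simp add: bind_map_pmf bind_assoc_pmf bind_return_pmf)
qed

lemma legal_queries_count_pcond:
  assumes "x \<in> {1..N}" "y \<in> {1..N}" "x \<noteq> y" "\<And>c. legal_queries N (k c)"
  shows "legal_queries N (count_pcond n x y k)"
  using assms(4) by (induction n arbitrary: k) (use assms(1-3) in auto)

lemma queries_le_count_pcond:
  "(\<And>c. queries_le N (k c) q) \<Longrightarrow> queries_le N (count_pcond n x y k) (n + q)"
  by (induction n arbitrary: k) auto

subsection \<open>Testing a single pair\<close>

definition pair_test :: "nat pmf \<Rightarrow> nat \<Rightarrow> real \<Rightarrow> nat \<Rightarrow> nat \<Rightarrow> tester" where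
  "pair_test p n \<tau> x y = count_pcond n x y (\<lambda>c.
     Output (if \<bar>real c / real n - pmf p x / (pmf p x + pmf p y)\<bar> < \<tau> then Accept else Reject))"

lemma accept_prob_pair_test:
  "accept_prob D P (pair_test p n \<tau> x y) =
     measure_pmf.prob (binomial_pmf n (pmf (P x y) x))
       {c. \<bar>real c / real n - pmf p x / (pmf p x + pmf p y)\<bar> < \<tau>}"
proof -
  have "accept_prob D P (pair_test p n \<tau> x y) =
    measure_pmf.expectation (binomial_pmf n (pmf (P x y) x))
      (\<lambda>c. indicator {c. \<bar>real c / real n - pmf p x / (pmf p x + pmf p y)\<bar> < \<tau>} c)"
    unfolding pair_test_def run_count_pcond pmf_bind
    by (intro Bochner_Integration.integral_cong) (auto simp: indicator_def)
  then show ?thesis by simp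
qed

text \<open>Hoeffding's inequality for the empirical frequency.\<close>

lemma binomial_deviation:
  assumes "b \<in> {0..1}" "0 < n" "0 \<le> \<tau>"
  shows "measure_pmf.prob (binomial_pmf n b) {c. \<bar>real c / real n - b\<bar> \<ge> \<tau>}
    \<le> 2 * exp (- 2 * real n * \<tau>\<^sup>2)"
proof -
  interpret binomial_distribution n b by unfold_locales (fact assms(1))
  show ?thesis using prob_abs_ge'[OF assms(2,3)] by simp
qed

lemma pair_test_complete:
  assumes "0 < n" "0 \<le> \<tau>" "pmf (P x y) x = pmf p x / (pmf p x + pmf p y)"
  shows "accept_prob D P (pair_test p n \<tau> x y) \<ge> 1 - 2 * exp (- 2 * real n * \<tau>\<^sup>2)"
proof -
  let ?b = "pmf (P x y) x"
  let ?S = "{c. \<bar>real c / real n - ?b\<bar> \<ge> \<tau>}"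
  have "measure_pmf.prob (binomial_pmf n ?b) (- ?S) = 1 - measure_pmf.prob (binomial_pmf n ?b) ?S"
    using measure_pmf.prob_compl[of ?S "binomial_pmf n ?b"] by (simp add: Compl_eq_Diff_UNIV)
  moreover have "- ?S = {c. \<bar>real c / real n - ?b\<bar> < \<tau>}"
    by auto
  ultimately show ?thesis
    using binomial_deviation[of ?b n \<tau>] assms(1,2) pmf_le_1[of "P x y" x]
    by (simp add: accept_prob_pair_test flip: assms(3))
qed

text \<open>Acceptance puts the empirical frequency within \<tau> of the expected ratio, from which
  the true bias is at least 2 \<tau> away; so the frequency must miss its own mean by
  \<tau>.\<close>

lemma pair_test_sound:
  assumes "0 < n" "0 \<le> \<tau>" "\<bar>pmf (P x y) x - pmf p x / (pmf p x + pmf p y)\<bar> \<ge> 2 * \<tau>"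
  shows "accept_prob D P (pair_test p n \<tau> x y) \<le> 2 * exp (- 2 * real n * \<tau>\<^sup>2)"
proof -
  let ?b = "pmf (P x y) x"
  have "measure_pmf.prob (binomial_pmf n ?b)
      {c. \<bar>real c / real n - pmf p x / (pmf p x + pmf p y)\<bar> < \<tau>}
    \<le> measure_pmf.prob (binomial_pmf n ?b) {c. \<bar>real c / real n - ?b\<bar> \<ge> \<tau>}"
    using assms(3) by (intro measure_pmf.finite_measure_mono) auto
  also have "\<dots> \<le> 2 * exp (- 2 * real n * \<tau>\<^sup>2)"
    by (rule binomial_deviation) (use assms in \<open>auto simp: pmf_le_1\<close>)
  finally show ?thesis by (simp add: accept_prob_pair_test)
qed

subsection \<open>Identity testing of the bucket weights\<close>

lemma finite_set_replicate_pmf: "finite (set_pmf Q) \<Longrightarrow> finite (set_pmf (replicate_pmf n Q))"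
  using finite_lists_length_eq[of "set_pmf Q" n]
  by (simp add: set_replicate_pmf lists_eq_set conj_commute)

lemma expectation_bind_finite:
  fixes h :: "'b \<Rightarrow> real"
  assumes "finite (set_pmf p)" "\<And>x. finite (set_pmf (f x))"
  shows "measure_pmf.expectation (bind_pmf p f) h =
    measure_pmf.expectation p (\<lambda>x. measure_pmf.expectation (f x) h)"
  using assms by (simp add: pmf_expectation_bind[of "set_pmf p"] integral_measure_pmf[of "set_pmf p"])

text \<open>The second moment is split into \<open>n\<close> times the variance of one summand plus
  the squared mean. Both identities follow by induction, conditioning on the first sample.\<close>

lemma
  fixes f :: "'a \<Rightarrow> real" and n :: nat
  assumes fin: "finite (set_pmf Q)"
  shows expectation_sum_replicate_pmf:
      "measure_pmf.expectation (replicate_pmf n Q) (\<lambda>xs. \<Sum>x\<leftarrow>xs. f x) =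
       n * measure_pmf.expectation Q f"
    and expectation_square_sum_replicate_pmf:
      "measure_pmf.expectation (replicate_pmf n Q) (\<lambda>xs. (\<Sum>x\<leftarrow>xs. f x)\<^sup>2) =
       n * (measure_pmf.expectation Q (\<lambda>x. (f x)\<^sup>2) - (measure_pmf.expectation Q f)\<^sup>2)
       + (real n)\<^sup>2 * (measure_pmf.expectation Q f)\<^sup>2"
proof -
  note int = integrable_measure_pmf_finite[OF fin]
    integrable_measure_pmf_finite[OF finite_set_replicate_pmf[OF fin]]
  have step: "measure_pmf.expectation (replicate_pmf (Suc n) Q) h =
      measure_pmf.expectation Q (\<lambda>x. measure_pmf.expectation (replicate_pmf n Q) (\<lambda>xs. h (x # xs)))"
    for n and h :: "'a list \<Rightarrow> real"
    by (simp add: expectation_bind_finite fin finite_set_replicate_pmf)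
  have *: "measure_pmf.expectation (replicate_pmf n Q) (\<lambda>xs. \<Sum>x\<leftarrow>xs. f x) =
       n * measure_pmf.expectation Q f" for n
    by (induction n) (simp_all add: step int algebra_simps del: replicate_pmf.simps(2))
  then show "measure_pmf.expectation (replicate_pmf n Q) (\<lambda>xs. \<Sum>x\<leftarrow>xs. f x) =
       n * measure_pmf.expectation Q f" .
  show "measure_pmf.expectation (replicate_pmf n Q) (\<lambda>xs. (\<Sum>x\<leftarrow>xs. f x)\<^sup>2) =
       n * (measure_pmf.expectation Q (\<lambda>x. (f x)\<^sup>2) - (measure_pmf.expectation Q f)\<^sup>2)
       + (real n)\<^sup>2 * (measure_pmf.expectation Q f)\<^sup>2"
  proof (induction n)
    case (Suc n)
    show ?case
      by (simp add: step int * Suc power2_sum del: replicate_pmf.simps(2))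
         (simp add: algebra_simps power2_eq_square)
  qed simp
qed

text \<open>Bias-variance decomposition around \<open>c\<close>, with the variance of one summand
  bounded by its second moment.\<close>

lemma mean_square_deviation:
  fixes f :: "'a \<Rightarrow> real"
  assumes fin: "finite (set_pmf Q)" and "0 < m"
  shows "measure_pmf.expectation (replicate_pmf m Q) (\<lambda>xs. ((\<Sum>x\<leftarrow>xs. f x) / m - c)\<^sup>2)
    \<le> measure_pmf.expectation Q (\<lambda>x. (f x)\<^sup>2) / m + (measure_pmf.expectation Q f - c)\<^sup>2"
proof -
  let ?E = "measure_pmf.expectation Q f" and ?F = "measure_pmf.expectation Q (\<lambda>x. (f x)\<^sup>2)"
  note int = integrable_measure_pmf_finite[OF finite_set_replicate_pmf[OF fin]]
  have "((\<Sum>x\<leftarrow>xs. f x) / m - c)\<^sup>2 =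
      (\<Sum>x\<leftarrow>xs. f x)\<^sup>2 / m\<^sup>2 - 2 * c / m * (\<Sum>x\<leftarrow>xs. f x) + c\<^sup>2" for xs
    by (simp add: power2_diff power_divide)
  then have "measure_pmf.expectation (replicate_pmf m Q) (\<lambda>xs. ((\<Sum>x\<leftarrow>xs. f x) / m - c)\<^sup>2) =
      (m * (?F - ?E\<^sup>2) + m\<^sup>2 * ?E\<^sup>2) / m\<^sup>2 - 2 * c / m * (m * ?E) + c\<^sup>2"
    by (simp add: int expectation_sum_replicate_pmf[OF fin]
        expectation_square_sum_replicate_pmf[OF fin])
  also have "\<dots> = (?F - ?E\<^sup>2) / m + (?E - c)\<^sup>2"
    using \<open>0 < m\<close> by (simp add: field_simps power2_eq_square)
  also have "\<dots> \<le> ?F / m + (?E - c)\<^sup>2"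
    by (simp add: divide_right_mono)
  finally show ?thesis .
qed

section \<open>Mean and variance of the bucket statistic\<close>

text \<open>The even mixture of \<open>P\<close> with the uniform weights on \<open>B\<close>
  buckets. It replaces \<open>P\<close> in the denominators of the usual \<chi>-square
  distance.\<close>

definition smoothed :: "nat pmf \<Rightarrow> nat \<Rightarrow> nat \<Rightarrow> real" where
  "smoothed P B j = (pmf P j + 1 / B) / 2"

definition scaled_deviation :: "nat pmf \<Rightarrow> nat \<Rightarrow> nat \<Rightarrow> nat list \<Rightarrow> nat \<Rightarrow> real" where
  "scaled_deviation P B m xs j = ((\<Sum>x\<leftarrow>xs. of_bool (x = j)) / m - pmf P j) / smoothed P B j"

text \<open>
  A bilinear form in the empirical deviations of two independent samples: its mean is
  \<open>chi_square P Q B\<close> with no bias from the diagonal, and its variance can be computed by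
  averaging first over \<open>ys\<close> and then over \<open>xs\<close>. Smoothing the weights by \<open>1 / B\<close> keeps
  the contribution of light buckets to the variance bounded.
\<close>

definition identity_stat :: "nat pmf \<Rightarrow> nat \<Rightarrow> nat \<Rightarrow> nat list \<Rightarrow> nat list \<Rightarrow> real" where
  "identity_stat P B m xs ys =
     (\<Sum>y\<leftarrow>ys. scaled_deviation P B m xs y) / m - (\<Sum>j<B. pmf P j * scaled_deviation P B m xs j)"

definition chi_square :: "nat pmf \<Rightarrow> nat pmf \<Rightarrow> nat \<Rightarrow> real" where
  "chi_square P Q B = (\<Sum>j<B. (pmf Q j - pmf P j)\<^sup>2 / smoothed P B j)"

lemma sum_list_sum_swap:
  "(\<Sum>x\<leftarrow>xs. \<Sum>j\<in>A. f x j) = (\<Sum>j\<in>A. \<Sum>x\<leftarrow>xs. (f x j :: 'a :: comm_monoid_add))"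
  by (induction xs) (simp_all add: sum.distrib)

text \<open>Condition on \<open>xs\<close>. Averaging over \<open>ys\<close> leaves a variance term
  and the square of a bias that is a linear form in the deviations of \<open>xs\<close>; averaging
  these over \<open>xs\<close> yields the two sums.\<close>

lemma identity_stat_mean_square:
  fixes P Q :: "nat pmf" and B m :: nat
  assumes supp: "set_pmf Q \<subseteq> {..<B}" and "0 < m"
  defines "R \<equiv> replicate_pmf m Q"
  defines "w \<equiv> smoothed P B" and "\<Delta> \<equiv> (\<lambda>j. pmf Q j - pmf P j)"
  shows "measure_pmf.expectation (pair_pmf R R)
      (\<lambda>(xs, ys). (identity_stat P B m xs ys - chi_square P Q B)\<^sup>2)
    \<le> (\<Sum>j<B. pmf Q j * ((pmf Q j / m + (\<Delta> j)\<^sup>2) / (w j)\<^sup>2)) / m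
      + (\<Sum>j<B. pmf Q j * (\<Delta> j / w j)\<^sup>2) / m"
proof -
  let ?\<theta> = "chi_square P Q B" and ?u = "scaled_deviation P B m"
  have finQ: "finite (set_pmf Q)"
    using supp finite_subset by blast
  have finR: "finite (set_pmf R)"
    unfolding R_def by (rule finite_set_replicate_pmf[OF finQ])
  note intR = integrable_measure_pmf_finite[OF finR]
  have EQ: "measure_pmf.expectation Q f = (\<Sum>j<B. pmf Q j * f j)" for f :: "nat \<Rightarrow> real"
    using supp by (simp add: integral_measure_pmf[of "{..<B}"] subset_iff)
  have inner: "measure_pmf.expectation R (\<lambda>ys. (identity_stat P B m xs ys - ?\<theta>)\<^sup>2)
      \<le> (\<Sum>j<B. pmf Q j * (?u xs j)\<^sup>2) / m + ((\<Sum>j<B. \<Delta> j * ?u xs j) - ?\<theta>)\<^sup>2" for xs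
  proof -
    let ?c = "(\<Sum>j<B. pmf P j * ?u xs j) + ?\<theta>"
    have "measure_pmf.expectation R (\<lambda>ys. ((\<Sum>y\<leftarrow>ys. ?u xs y) / m - ?c)\<^sup>2)
      \<le> measure_pmf.expectation Q (\<lambda>y. (?u xs y)\<^sup>2) / m + (measure_pmf.expectation Q (?u xs) - ?c)\<^sup>2"
      unfolding R_def by (rule mean_square_deviation[OF finQ \<open>0 < m\<close>])
    moreover have "measure_pmf.expectation Q (?u xs) - ?c = (\<Sum>j<B. \<Delta> j * ?u xs j) - ?\<theta>"
      by (simp add: EQ \<Delta>_def left_diff_distrib sum_subtractf)
    ultimately show ?thesis
      by (simp add: EQ identity_stat_def algebra_simps)
  qed
  \<comment> \<open>The deviation at \<open>j\<close> averages the indicators of \<open>j\<close>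
    over \<open>xs\<close>: second moment \<open>pmf Q j\<close>, bias
    \<open>\<Delta> j\<close>.\<close>
  have first: "measure_pmf.expectation R (\<lambda>xs. (?u xs j)\<^sup>2)
      \<le> (pmf Q j / m + (\<Delta> j)\<^sup>2) / (w j)\<^sup>2" if "j < B" for j
  proof -
    have E: "measure_pmf.expectation Q (\<lambda>x. of_bool (x = j)) = pmf Q j"
      using that by (simp add: EQ if_distrib of_bool_def cong: if_cong)
    have "measure_pmf.expectation R (\<lambda>xs. ((\<Sum>x\<leftarrow>xs. of_bool (x = j)) / m - pmf P j)\<^sup>2)
      \<le> measure_pmf.expectation Q (\<lambda>x. (of_bool (x = j))\<^sup>2) / m
        + (measure_pmf.expectation Q (\<lambda>x. of_bool (x = j)) - pmf P j)\<^sup>2"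
      unfolding R_def by (rule mean_square_deviation[OF finQ \<open>0 < m\<close>])
    also have "(\<lambda>x. (of_bool (x = j))\<^sup>2 :: real) = (\<lambda>x. of_bool (x = j))"
      by auto
    finally have "measure_pmf.expectation R (\<lambda>xs. ((\<Sum>x\<leftarrow>xs. of_bool (x = j)) / m - pmf P j)\<^sup>2)
      \<le> pmf Q j / m + (\<Delta> j)\<^sup>2"
      unfolding E \<Delta>_def .
    then have "measure_pmf.expectation R (\<lambda>xs. ((\<Sum>x\<leftarrow>xs. of_bool (x = j)) / m - pmf P j)\<^sup>2) / (w j)\<^sup>2
      \<le> (pmf Q j / m + (\<Delta> j)\<^sup>2) / (w j)\<^sup>2"
      by (intro divide_right_mono) auto
    then show ?thesis
      by (simp add: scaled_deviation_def power_divide w_def)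
  qed
  have second: "measure_pmf.expectation R (\<lambda>xs. ((\<Sum>j<B. \<Delta> j * ?u xs j) - ?\<theta>)\<^sup>2)
      \<le> (\<Sum>j<B. pmf Q j * (\<Delta> j / w j)\<^sup>2) / m"
  proof -
    \<comment> \<open>The linear form minus its mean is the average of \<open>\<phi>\<close> over
      \<open>xs\<close> minus \<open>c\<close>, and \<open>c\<close> is exactly the mean of
      \<open>\<phi>\<close> under \<open>Q\<close>; hence no bias term remains.\<close>
    define \<phi> where "\<phi> x = (\<Sum>j<B. \<Delta> j / w j * of_bool (x = j))" for x
    define c where "c = (\<Sum>j<B. pmf P j * (\<Delta> j / w j)) + ?\<theta>"
    have \<phi>: "\<phi> j = \<Delta> j / w j" if "j < B" for j
      using that by (simp add: \<phi>_def of_bool_def if_distrib cong: if_cong)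
    have "(\<Sum>x\<leftarrow>xs. \<phi> x) / m - c = (\<Sum>j<B. \<Delta> j * ?u xs j) - ?\<theta>" for xs
    proof -
      have "(\<Sum>x\<leftarrow>xs. \<phi> x) = (\<Sum>j<B. \<Delta> j / w j * (\<Sum>x\<leftarrow>xs. of_bool (x = j)))"
        unfolding \<phi>_def by (simp add: sum_list_sum_swap flip: sum_list_const_mult)
      then show ?thesis
        by (simp add: c_def scaled_deviation_def w_def sum_divide_distrib diff_divide_distrib
            right_diff_distrib sum_subtractf mult_ac)
    qed
    moreover have "measure_pmf.expectation Q \<phi> - c = 0"
    proof -
      have "measure_pmf.expectation Q \<phi> = (\<Sum>j<B. pmf Q j * (\<Delta> j / w j))"
        using \<phi> by (simp add: EQ)
      moreover have "?\<theta> = (\<Sum>j<B. \<Delta> j * (\<Delta> j / w j))"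
        by (simp add: chi_square_def \<Delta>_def w_def power2_eq_square)
      moreover have "(\<Sum>j<B. \<Delta> j * (\<Delta> j / w j)) =
          (\<Sum>j<B. pmf Q j * (\<Delta> j / w j)) - (\<Sum>j<B. pmf P j * (\<Delta> j / w j))"
        unfolding sum_subtractf[symmetric]
        by (intro sum.cong refl, subst (1) \<Delta>_def) (simp add: left_diff_distrib diff_divide_distrib)
      ultimately show ?thesis
        unfolding c_def by simp
    qed
    moreover have "measure_pmf.expectation Q (\<lambda>x. (\<phi> x)\<^sup>2) = (\<Sum>j<B. pmf Q j * (\<Delta> j / w j)\<^sup>2)"
      using \<phi> by (simp add: EQ)
    ultimately show ?thesis
      using mean_square_deviation[OF finQ \<open>0 < m\<close>, of \<phi> c] by (simp add: R_def)
  qed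
  have "measure_pmf.expectation (pair_pmf R R)
      (\<lambda>(xs, ys). (identity_stat P B m xs ys - ?\<theta>)\<^sup>2) =
    measure_pmf.expectation R (\<lambda>xs. measure_pmf.expectation R (\<lambda>ys. (identity_stat P B m xs ys - ?\<theta>)\<^sup>2))"
    unfolding pair_pmf_def by (simp add: expectation_bind_finite finR)
  also have "\<dots> \<le> measure_pmf.expectation R (\<lambda>xs.
      (\<Sum>j<B. pmf Q j * (?u xs j)\<^sup>2) / m + ((\<Sum>j<B. \<Delta> j * ?u xs j) - ?\<theta>)\<^sup>2)"
    by (intro integral_mono intR inner)
  also have "\<dots> = (\<Sum>j<B. pmf Q j * measure_pmf.expectation R (\<lambda>xs. (?u xs j)\<^sup>2)) / m
      + measure_pmf.expectation R (\<lambda>xs. ((\<Sum>j<B. \<Delta> j * ?u xs j) - ?\<theta>)\<^sup>2)"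
    by (simp add: intR)
  also have "\<dots> \<le> (\<Sum>j<B. pmf Q j * ((pmf Q j / m + (\<Delta> j)\<^sup>2) / (w j)\<^sup>2)) / m
      + (\<Sum>j<B. pmf Q j * (\<Delta> j / w j)\<^sup>2) / m"
    by (intro add_mono second divide_right_mono sum_mono mult_left_mono first) auto
  finally show ?thesis .
qed

lemma smoothed_bounds:
  assumes "0 < B"
  shows "0 < smoothed P B j" "pmf P j \<le> 2 * smoothed P B j" "1 / smoothed P B j \<le> 2 * B"
proof -
  have lower: "0 < 1 / (2 * real B)" "1 / (2 * real B) \<le> smoothed P B j"
    using assms by (simp_all add: smoothed_def field_simps)
  show "0 < smoothed P B j"
    using lower by (rule less_le_trans)
  have "1 / smoothed P B j \<le> 1 / (1 / (2 * real B))"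
    by (rule frac_le) (use lower in auto)
  then show "1 / smoothed P B j \<le> 2 * B"
    by simp
  show "pmf P j \<le> 2 * smoothed P B j"
    by (simp add: smoothed_def)
qed

text \<open>Chebyshev's inequality. The bounds
  \<open>pmf Q j \<le> 2 * w j + \<bar>\<Delta> j\<bar>\<close> and
  \<open>1 / w j \<le> 2 * B\<close> express the variance through \<open>B\<close>, \<open>m\<close>
  and \<open>\<theta>\<close> alone. For \<theta> = 0 only 8 B / m^2 remains, which is why about
  sqrt B samples suffice.\<close>

lemma identity_stat_deviation:
  fixes P Q :: "nat pmf" and B m :: nat and a \<theta> :: real
  assumes supp: "set_pmf Q \<subseteq> {..<B}" and m: "0 < m" and "0 < a"
  defines "\<theta> \<equiv> chi_square P Q B"
  shows "measure_pmf.prob (pair_pmf (replicate_pmf m Q) (replicate_pmf m Q))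
      {(xs, ys). \<bar>identity_stat P B m xs ys - \<theta>\<bar> \<ge> a}
    \<le> ((8 * B + 4 * B * \<theta>) / m\<^sup>2 + 2 * ((2 + sqrt (2 * B * \<theta>)) * \<theta>) / m) / a\<^sup>2"
proof -
  let ?J = "pair_pmf (replicate_pmf m Q) (replicate_pmf m Q)"
  let ?f = "\<lambda>(xs, ys). identity_stat P B m xs ys - \<theta>"
  define w where "w = smoothed P B"
  define \<Delta> where "\<Delta> j = pmf Q j - pmf P j" for j
  have B: "0 < B"
    using supp set_pmf_not_empty[of Q] by (cases B) auto
  have w: "0 < w j" "pmf P j \<le> 2 * w j" "1 / w j \<le> 2 * B" for j
    using smoothed_bounds[OF B] by (auto simp: w_def)
  have \<theta>: "\<theta> = (\<Sum>j<B. (\<Delta> j)\<^sup>2 / w j)"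
    by (simp add: \<theta>_def chi_square_def w_def \<Delta>_def)
  have fin: "finite (set_pmf ?J)"
    using finite_set_replicate_pmf[of Q m] supp by (auto intro: finite_subset)
  have \<theta>_ge: "(\<Delta> j)\<^sup>2 / w j \<le> \<theta>" if "j < B" for j
    unfolding \<theta> using that w by (intro member_le_sum) (auto intro!: divide_nonneg_pos)
  have Q_le: "pmf Q j \<le> 2 * w j + \<bar>\<Delta> j\<bar>" for j
    using w(2)[of j] by (simp add: \<Delta>_def)
  have ratio: "(\<Delta> j / w j)\<^sup>2 \<le> 2 * B * ((\<Delta> j)\<^sup>2 / w j)" for j
  proof -
    have "(\<Delta> j / w j)\<^sup>2 = 1 / w j * ((\<Delta> j)\<^sup>2 / w j)"
      by (simp add: power_divide power2_eq_square)
    also have "\<dots> \<le> 2 * B * ((\<Delta> j)\<^sup>2 / w j)"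
      using w[of j] by (intro mult_right_mono) auto
    finally show ?thesis .
  qed
  have ratio_abs: "\<bar>\<Delta> j\<bar> / w j \<le> sqrt (2 * B * \<theta>)" if "j < B" for j
  proof (rule real_le_rsqrt)
    have "(\<bar>\<Delta> j\<bar> / w j)\<^sup>2 \<le> 2 * B * ((\<Delta> j)\<^sup>2 / w j)"
      using ratio[of j] by (simp add: power_divide)
    also have "\<dots> \<le> 2 * B * \<theta>"
      using \<theta>_ge[OF that] by (intro mult_left_mono) auto
    finally show "(\<bar>\<Delta> j\<bar> / w j)\<^sup>2 \<le> 2 * B * \<theta>" .
  qed
  have S1: "(\<Sum>j<B. pmf Q j * pmf Q j / (w j)\<^sup>2) \<le> 8 * B + 4 * B * \<theta>"
  proof -
    have "pmf Q j * pmf Q j / (w j)\<^sup>2 \<le> 8 + 4 * B * ((\<Delta> j)\<^sup>2 / w j)" for j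
    proof -
      have "pmf Q j * pmf Q j \<le> (2 * w j + \<bar>\<Delta> j\<bar>) * (2 * w j + \<bar>\<Delta> j\<bar>)"
        using Q_le order_trans[OF pmf_nonneg Q_le] by (intro mult_mono) auto
      \<comment> \<open>The right-hand side is the sum of the squares of 2w + |\<Delta>| and 2w -
        |\<Delta>|.\<close>
      also have "\<dots> \<le> 8 * (w j)\<^sup>2 + 2 * (\<Delta> j)\<^sup>2"
        using zero_le_power2[of "2 * w j - \<bar>\<Delta> j\<bar>"]
        by (simp add: power2_eq_square algebra_simps)
      finally have "pmf Q j * pmf Q j / (w j)\<^sup>2 \<le> (8 * (w j)\<^sup>2 + 2 * (\<Delta> j)\<^sup>2) / (w j)\<^sup>2"
        by (intro divide_right_mono) auto
      also have "\<dots> = 8 + 2 * (\<Delta> j / w j)\<^sup>2"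
        using w(1)[of j] by (simp add: add_divide_distrib power_divide)
      finally show ?thesis
        using ratio[of j] by simp
    qed
    then have "(\<Sum>j<B. pmf Q j * pmf Q j / (w j)\<^sup>2) \<le> (\<Sum>j<B. 8 + 4 * B * ((\<Delta> j)\<^sup>2 / w j))"
      by (intro sum_mono) auto
    also have "\<dots> = 8 * B + 4 * B * \<theta>"
      by (simp add: sum.distrib \<theta> sum_distrib_left)
    finally show ?thesis .
  qed
  have S2: "(\<Sum>j<B. pmf Q j * (\<Delta> j / w j)\<^sup>2) \<le> (2 + sqrt (2 * B * \<theta>)) * \<theta>"
  proof -
    have "pmf Q j * (\<Delta> j / w j)\<^sup>2 \<le> (2 + sqrt (2 * B * \<theta>)) * ((\<Delta> j)\<^sup>2 / w j)" if "j < B" for j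
    proof -
      have "pmf Q j * (\<Delta> j / w j)\<^sup>2 \<le> (2 * w j + \<bar>\<Delta> j\<bar>) * (\<Delta> j / w j)\<^sup>2"
        using Q_le by (intro mult_right_mono) auto
      also have "\<dots> = (2 + \<bar>\<Delta> j\<bar> / w j) * ((\<Delta> j)\<^sup>2 / w j)"
        using w(1)[of j] by (simp add: field_simps power2_eq_square)
      also have "\<dots> \<le> (2 + sqrt (2 * B * \<theta>)) * ((\<Delta> j)\<^sup>2 / w j)"
        using ratio_abs[OF that] w(1)[of j] by (intro mult_right_mono) auto
      finally show ?thesis .
    qed
    then have "(\<Sum>j<B. pmf Q j * (\<Delta> j / w j)\<^sup>2)
        \<le> (\<Sum>j<B. (2 + sqrt (2 * B * \<theta>)) * ((\<Delta> j)\<^sup>2 / w j))"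
      by (intro sum_mono) auto
    also have "\<dots> = (2 + sqrt (2 * B * \<theta>)) * \<theta>"
      unfolding \<theta> by (simp only: sum_distrib_left)
    finally show ?thesis .
  qed
  have "measure_pmf.prob ?J {z. \<bar>?f z\<bar> \<ge> a} \<le> measure_pmf.expectation ?J (\<lambda>z. (?f z)\<^sup>2) / a\<^sup>2"
    using measure_pmf.second_moment_method[of ?f ?J a] \<open>0 < a\<close>
    by (simp add: integrable_measure_pmf_finite[OF fin])
  also have "measure_pmf.expectation ?J (\<lambda>z. (?f z)\<^sup>2) =
      measure_pmf.expectation ?J (\<lambda>(xs, ys). (identity_stat P B m xs ys - \<theta>)\<^sup>2)"
    by (simp add: case_prod_unfold)
  also have "\<dots> / a\<^sup>2 \<le> ((8 * B + 4 * B * \<theta>) / m\<^sup>2 + 2 * ((2 + sqrt (2 * B * \<theta>)) * \<theta>) / m) / a\<^sup>2"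
  proof (intro divide_right_mono)
    have "measure_pmf.expectation ?J (\<lambda>(xs, ys). (identity_stat P B m xs ys - \<theta>)\<^sup>2)
      \<le> (\<Sum>j<B. pmf Q j * ((pmf Q j / m + (\<Delta> j)\<^sup>2) / (w j)\<^sup>2)) / m
        + (\<Sum>j<B. pmf Q j * (\<Delta> j / w j)\<^sup>2) / m"
      unfolding \<theta>_def w_def \<Delta>_def by (rule identity_stat_mean_square[OF supp m])
    \<comment> \<open>The bias part of the first sum coincides with the second sum; this is the
      origin of the factor 2.\<close>
    also have "(\<Sum>j<B. pmf Q j * ((pmf Q j / m + (\<Delta> j)\<^sup>2) / (w j)\<^sup>2)) =
        (\<Sum>j<B. pmf Q j * pmf Q j / (w j)\<^sup>2) / m + (\<Sum>j<B. pmf Q j * (\<Delta> j / w j)\<^sup>2)"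
      unfolding sum_divide_distrib sum.distrib[symmetric]
      by (intro sum.cong refl) (simp add: add_divide_distrib power_divide distrib_left mult_ac)
    also have "\<dots> / m + (\<Sum>j<B. pmf Q j * (\<Delta> j / w j)\<^sup>2) / m =
        (\<Sum>j<B. pmf Q j * pmf Q j / (w j)\<^sup>2) / m\<^sup>2
        + 2 * (\<Sum>j<B. pmf Q j * (\<Delta> j / w j)\<^sup>2) / m"
      by (simp add: add_divide_distrib power2_eq_square)
    also have "\<dots> \<le> (8 * B + 4 * B * \<theta>) / m\<^sup>2 + 2 * ((2 + sqrt (2 * B * \<theta>)) * \<theta>) / m"
      by (intro add_mono divide_right_mono mult_left_mono S1 S2) auto
    finally show "measure_pmf.expectation ?J (\<lambda>(xs, ys). (identity_stat P B m xs ys - \<theta>)\<^sup>2)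
      \<le> (8 * B + 4 * B * \<theta>) / m\<^sup>2 + 2 * ((2 + sqrt (2 * B * \<theta>)) * \<theta>) / m" .
  qed simp
  finally show ?thesis
    by (simp add: case_prod_unfold)
qed

text \<open>Cauchy-Schwarz: the smoothed weights sum to 1 over the buckets, so they act as a
  probability vector.\<close>

lemma chi_square_ge:
  assumes "set_pmf P \<subseteq> {..<B}" "0 < B"
  shows "(\<Sum>j<B. \<bar>pmf Q j - pmf P j\<bar>)\<^sup>2 \<le> chi_square P Q B"
proof -
  define w where "w = smoothed P B"
  have w: "0 < w j" "w j \<noteq> 0" "0 \<le> w j" for j
    using smoothed_bounds(1)[OF assms(2), of P j] by (simp_all add: w_def)
  have "(\<Sum>j<B. \<bar>pmf Q j - pmf P j\<bar>) = (\<Sum>j<B. (\<bar>pmf Q j - pmf P j\<bar> / sqrt (w j)) * sqrt (w j))"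
    by (intro sum.cong refl) (simp add: w)
  then have "(\<Sum>j<B. \<bar>pmf Q j - pmf P j\<bar>)\<^sup>2 \<le>
      (\<Sum>j<B. (\<bar>pmf Q j - pmf P j\<bar> / sqrt (w j))\<^sup>2) * (\<Sum>j<B. (sqrt (w j))\<^sup>2)"
    using Cauchy_Schwarz_ineq_sum[of "\<lambda>j. \<bar>pmf Q j - pmf P j\<bar> / sqrt (w j)" "\<lambda>j. sqrt (w j)"]
    by (simp only:)
  also have "(\<Sum>j<B. (sqrt (w j))\<^sup>2) = (\<Sum>j<B. (pmf P j + 1 / B) / 2)"
    by (intro sum.cong refl) (simp add: w, simp add: w_def smoothed_def)
  also have "\<dots> = ((\<Sum>j<B. pmf P j) + 1) / 2"
    using assms(2) unfolding sum_divide_distrib[symmetric] sum.distrib by simp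
  also have "(\<Sum>j<B. pmf P j) = 1"
    using assms by (intro sum_pmf_eq_1) auto
  also have "(\<Sum>j<B. (\<bar>pmf Q j - pmf P j\<bar> / sqrt (w j))\<^sup>2) = chi_square P Q B"
    using w by (simp add: chi_square_def w_def power_divide)
  finally show ?thesis by simp
qed

section \<open>Completeness and soundness of the bucket test\<close>

definition bucket_test :: "nat pmf \<Rightarrow> (nat \<Rightarrow> nat) \<Rightarrow> nat \<Rightarrow> nat \<Rightarrow> real \<Rightarrow> tester" where
  "bucket_test p \<beta> B m \<tau> = draw_samples m (\<lambda>xs. draw_samples m (\<lambda>ys.
     Output (if identity_stat (map_pmf \<beta> p) B m (map \<beta> xs) (map \<beta> ys) < \<tau> then Accept else Reject)))"

lemma replicate_pmf_map: "replicate_pmf n (map_pmf f p) = map_pmf (map f) (replicate_pmf n p)"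
  by (induction n) (simp_all add: map_bind_pmf bind_map_pmf)

lemma accept_prob_bucket_test:
  defines "R \<equiv> \<lambda>D \<beta> m. replicate_pmf m (map_pmf \<beta> D)"
  shows "accept_prob D P (bucket_test p \<beta> B m \<tau>) =
    measure_pmf.prob (pair_pmf (R D \<beta> m) (R D \<beta> m))
      {(xs, ys). identity_stat (map_pmf \<beta> p) B m xs ys < \<tau>}"
proof -
  let ?v = "\<lambda>(xs, ys). if identity_stat (map_pmf \<beta> p) B m xs ys < \<tau> then Accept else Reject"
  have "run D P (bucket_test p \<beta> B m \<tau>) = map_pmf ?v (pair_pmf (R D \<beta> m) (R D \<beta> m))"
    by (simp add: bucket_test_def run_draw_samples R_def replicate_pmf_map pair_pmf_def
        map_bind_pmf bind_map_pmf bind_assoc_pmf bind_return_pmf)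
  then have "accept_prob D P (bucket_test p \<beta> B m \<tau>) =
      measure_pmf.prob (pair_pmf (R D \<beta> m) (R D \<beta> m)) (?v -` {Accept})"
    by (simp add: pmf_map)
  also have "?v -` {Accept} = {(xs, ys). identity_stat (map_pmf \<beta> p) B m xs ys < \<tau>}"
    by (auto split: if_splits)
  finally show ?thesis .
qed

lemma legal_queries_bucket_test: "legal_queries N (bucket_test p \<beta> B m \<tau>)"
  unfolding bucket_test_def by (intro legal_queries_draw_samples) simp

lemma queries_le_bucket_test: "queries_le N (bucket_test p \<beta> B m \<tau>) (2 * m)"
proof -
  have "queries_le N (bucket_test p \<beta> B m \<tau>) (m + (m + 0))"
    unfolding bucket_test_def by (intro queries_le_draw_samples) simp
  then show ?thesis by (simp add: mult_2)
qed

text \<open>For \<open>D = p\<close> the statistic has mean 0, and Chebyshev at \<epsilon>^2 / 2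
  bounds the rejection probability by 32 B / (m^2 \<epsilon>^4), which is at most 32 /
  10000.\<close>

lemma bucket_test_complete:
  assumes supp: "\<beta> ` set_pmf p \<subseteq> {..<B}" and "0 < \<epsilon>" and m: "real m \<ge> 100 * sqrt B / \<epsilon>\<^sup>2"
  shows "accept_prob p P (bucket_test p \<beta> B m (\<epsilon>\<^sup>2 / 2)) \<ge> 9 / 10"
proof -
  let ?Q = "map_pmf \<beta> p"
  let ?J = "pair_pmf (replicate_pmf m ?Q) (replicate_pmf m ?Q)"
  let ?S = "{(xs, ys). \<bar>identity_stat ?Q B m xs ys - chi_square ?Q ?Q B\<bar> \<ge> \<epsilon>\<^sup>2 / 2}"
  have B: "0 < B"
    using supp set_pmf_not_empty[of p] by (cases B) auto
  have "0 < 100 * sqrt B / \<epsilon>\<^sup>2"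
    using B \<open>0 < \<epsilon>\<close> by simp
  with m have m0: "0 < real m" by linarith
  have chi: "chi_square ?Q ?Q B = 0"
    by (simp add: chi_square_def)
  have sB: "100 * sqrt B \<le> m * \<epsilon>\<^sup>2"
    using m \<open>0 < \<epsilon>\<close> by (simp add: field_simps)
  then have "(100 * sqrt B)\<^sup>2 \<le> (m * \<epsilon>\<^sup>2)\<^sup>2"
    by (intro power_mono) auto
  then have sB2: "10000 * real B \<le> (real m)\<^sup>2 * (\<epsilon>\<^sup>2)\<^sup>2"
    by (simp add: power_mult_distrib)
  have "measure_pmf.prob ?J ?S \<le> (8 * B / m\<^sup>2) / (\<epsilon>\<^sup>2 / 2)\<^sup>2"
    using identity_stat_deviation[of ?Q B m "\<epsilon>\<^sup>2 / 2" ?Q] supp m0 \<open>0 < \<epsilon>\<close> by (simp add: chi)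
  also have "\<dots> \<le> 1 / 10"
    using sB2 m0 \<open>0 < \<epsilon>\<close> by (simp add: field_simps)
  finally have "measure_pmf.prob ?J ?S \<le> 1 / 10" .
  moreover have "measure_pmf.prob ?J (- ?S) = 1 - measure_pmf.prob ?J ?S"
    using measure_pmf.prob_compl[of ?S ?J] by (simp add: Compl_eq_Diff_UNIV)
  moreover have "measure_pmf.prob ?J (- ?S)
      \<le> measure_pmf.prob ?J {(xs, ys). identity_stat ?Q B m xs ys < \<epsilon>\<^sup>2 / 2}"
    by (intro measure_pmf.finite_measure_mono) (auto simp: chi)
  ultimately show ?thesis
    by (simp add: accept_prob_bucket_test)
qed

text \<open>Distance \<epsilon> of the bucket weights forces \<theta> \<ge> \<epsilon>^2, so the
  threshold is at most \<theta> / 2 and acceptance needs a deviation of at least \<theta> / 2. The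
  variance is compared with \<theta>^2 rather than \<epsilon>^4 because \<theta> may be much larger
  than \<epsilon>^2.\<close>

lemma bucket_test_sound:
  assumes supp: "\<beta> ` set_pmf p \<subseteq> {..<B}" "\<beta> ` set_pmf D \<subseteq> {..<B}"
    and \<epsilon>: "0 < \<epsilon>" "\<epsilon> < 1" and m: "real m \<ge> 100 * sqrt B / \<epsilon>\<^sup>2"
    and far: "(\<Sum>j<B. \<bar>pmf (map_pmf \<beta> D) j - pmf (map_pmf \<beta> p) j\<bar>) \<ge> \<epsilon>"
  shows "accept_prob D P (bucket_test p \<beta> B m (\<epsilon>\<^sup>2 / 2)) \<le> 1 / 3"
proof -
  let ?P = "map_pmf \<beta> p" and ?Q = "map_pmf \<beta> D"
  let ?J = "pair_pmf (replicate_pmf m ?Q) (replicate_pmf m ?Q)"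
  define \<theta> where "\<theta> = chi_square ?P ?Q B"
  have B: "0 < B"
    using supp set_pmf_not_empty[of p] by (cases B) auto
  have "0 < 100 * sqrt B / \<epsilon>\<^sup>2"
    using B \<epsilon> by simp
  with m have m0: "0 < real m" by linarith
  have "\<epsilon>\<^sup>2 \<le> (\<Sum>j<B. \<bar>pmf ?Q j - pmf ?P j\<bar>)\<^sup>2"
    using far \<epsilon> by (intro power_mono) auto
  also have "\<dots> \<le> \<theta>"
    unfolding \<theta>_def using supp B by (intro chi_square_ge) auto
  finally have \<theta>: "\<epsilon>\<^sup>2 \<le> \<theta>" .
  then have \<theta>0: "0 < \<theta>"
    using \<epsilon> by (smt (verit) zero_less_power)
  have sB: "sqrt B / m \<le> \<epsilon>\<^sup>2 / 100"
    using m m0 \<epsilon> by (simp add: field_simps)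
  have "(sqrt B / m)\<^sup>2 \<le> (\<epsilon>\<^sup>2 / 100)\<^sup>2"
    using sB by (intro power_mono) auto
  then have sB2: "real B / m\<^sup>2 \<le> (\<epsilon>\<^sup>2)\<^sup>2 / 10000"
    by (simp add: power_divide)
  have inv_m: "1 / m \<le> \<epsilon>\<^sup>2 / 100"
    using sB m0 B by (smt (verit) divide_right_mono real_sqrt_ge_1_iff of_nat_0_le_iff of_nat_1 of_nat_le_iff
        Suc_leI One_nat_def)
  have V1: "(8 * B + 4 * B * \<theta>) / m\<^sup>2 \<le> 12 * \<theta>\<^sup>2 / 10000"
  proof -
    have "(8 * B + 4 * B * \<theta>) / m\<^sup>2 = (8 + 4 * \<theta>) * (real B / m\<^sup>2)"
      by (simp add: field_simps)
    also have "\<dots> \<le> (8 + 4 * \<theta>) * ((\<epsilon>\<^sup>2)\<^sup>2 / 10000)"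
      using sB2 \<theta>0 by (intro mult_left_mono) auto
    also have "\<dots> = (8 * (\<epsilon>\<^sup>2 * \<epsilon>\<^sup>2) + 4 * \<theta> * (\<epsilon>\<^sup>2 * \<epsilon>\<^sup>2)) / 10000"
      by (simp add: power2_eq_square algebra_simps)
    also have "\<dots> \<le> (8 * (\<theta> * \<theta>) + 4 * \<theta> * (1 * \<theta>)) / 10000"
      using \<theta> \<theta>0 \<epsilon> by (intro divide_right_mono add_mono mult_left_mono mult_mono)
        (auto simp: power_le_one)
    finally show ?thesis by (simp add: power2_eq_square)
  qed
  \<comment> \<open>The term with sqrt B is absorbed through \<epsilon>^2 \<le> \<epsilon> \<le>
    sqrt \<theta>.\<close>
  have V2: "2 * ((2 + sqrt (2 * B * \<theta>)) * \<theta>) / m \<le> 7 * \<theta>\<^sup>2 / 100"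
  proof -
    have "sqrt \<theta> * \<epsilon>\<^sup>2 \<le> \<theta>"
    proof -
      have "\<epsilon> \<le> sqrt \<theta>"
        using \<theta> by (rule real_le_rsqrt)
      moreover have "\<epsilon>\<^sup>2 \<le> \<epsilon>"
        using \<epsilon> by (simp add: power2_eq_square mult_left_le)
      ultimately have "sqrt \<theta> * \<epsilon>\<^sup>2 \<le> sqrt \<theta> * sqrt \<theta>"
        using \<theta>0 by (intro mult_left_mono) auto
      then show ?thesis using \<theta>0 by simp
    qed
    moreover have "sqrt 2 \<le> (3 / 2 :: real)"
      by (rule real_le_lsqrt) (simp_all add: power2_eq_square)
    ultimately have *: "sqrt 2 * (sqrt \<theta> * \<epsilon>\<^sup>2) \<le> 3 / 2 * \<theta>"
      using \<theta>0 by (intro mult_mono) auto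
    have "2 * ((2 + sqrt (2 * B * \<theta>)) * \<theta>) / m =
        2 * \<theta> * (2 * (1 / m) + sqrt 2 * sqrt \<theta> * (sqrt B / m))"
      by (simp add: real_sqrt_mult algebra_simps add_divide_distrib)
    also have "\<dots> \<le> 2 * \<theta> * (2 * (\<epsilon>\<^sup>2 / 100) + sqrt 2 * sqrt \<theta> * (\<epsilon>\<^sup>2 / 100))"
      using inv_m sB \<theta>0 by (intro mult_left_mono add_mono) auto
    also have "\<dots> \<le> 2 * \<theta> * (2 * (\<theta> / 100) + 3 / 2 * \<theta> / 100)"
      using \<theta> * \<theta>0 by (intro mult_left_mono add_mono) (auto simp: mult_ac)
    finally show ?thesis by (simp add: power2_eq_square)
  qed
  have "accept_prob D P (bucket_test p \<beta> B m (\<epsilon>\<^sup>2 / 2)) =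
      measure_pmf.prob ?J {(xs, ys). identity_stat ?P B m xs ys < \<epsilon>\<^sup>2 / 2}"
    by (simp add: accept_prob_bucket_test)
  also have "\<dots> \<le> measure_pmf.prob ?J {(xs, ys). \<bar>identity_stat ?P B m xs ys - \<theta>\<bar> \<ge> \<theta> / 2}"
    using \<theta> by (intro measure_pmf.finite_measure_mono) (auto simp: abs_if)
  also have "\<dots> \<le> ((8 * B + 4 * B * \<theta>) / m\<^sup>2 + 2 * ((2 + sqrt (2 * B * \<theta>)) * \<theta>) / m) / (\<theta> / 2)\<^sup>2"
    unfolding \<theta>_def
    by (rule identity_stat_deviation) (use supp m0 \<theta>0 in \<open>auto simp: \<theta>_def\<close>)
  also have "\<dots> \<le> (12 * \<theta>\<^sup>2 / 10000 + 7 * \<theta>\<^sup>2 / 100) / (\<theta> / 2)\<^sup>2"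
    by (intro divide_right_mono add_mono V1 V2) auto
  also have "\<dots> \<le> 1 / 3"
    using \<theta>0 by (simp add: field_simps)
  finally show ?thesis .
qed

subsection \<open>Gaps of pair queries\<close>

text \<open>Here \<open>a\<close>, \<open>b\<close> play the masses of \<open>x\<close>,
  \<open>y\<close> under \<open>D\<close>, and \<open>u\<close>, \<open>v\<close> those under the
  known distribution. If a v > b u, the gap is (a v - b u) / ((a + b)(u + v)), and a v / ((a + b)(u
  + v)) \<ge> u v / (u + v)^2 \<ge> 2 / 9, where the last bound is attained at ratio 2. Otherwise
  the left side is not positive.\<close>

lemma pair_ratio_bound:
  fixes a b u v :: real
  assumes "0 \<le> a" "0 \<le> b" "0 < u" "0 < v" "u \<le> 2 * v" "v \<le> 2 * u"
  shows "2 / 9 * (a * v - b * u) \<le> a * v * \<bar>a / (a + b) - u / (u + v)\<bar>"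
proof (cases "a * v > b * u")
  case True
  then have a: "0 < a"
    using assms by (smt (verit) mult_eq_0_iff mult_nonneg_nonneg)
  have "a / (a + b) - u / (u + v) = (a * v - b * u) / ((a + b) * (u + v))"
    using a assms by (simp add: field_simps)
  then have eq: "\<bar>a / (a + b) - u / (u + v)\<bar> = (a * v - b * u) / ((a + b) * (u + v))"
    using True a assms by simp
  have "(a + b) * u \<le> a * (u + v)"
    using True by (simp add: algebra_simps)
  then have "2 * ((a + b) * (u + v)) * u \<le> 2 * (a * (u + v) * (u + v))"
    using assms mult_right_mono[of "(a + b) * u" "a * (u + v)" "u + v"] by (simp add: algebra_simps)
  also have "\<dots> \<le> 9 * (a * v) * u"
  proof -
    \<comment> \<open>The product equals a (9 u v - 2 (u + v)^2).\<close>
    have "0 \<le> a * ((2 * v - u) * (2 * u - v))"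
      using assms a by simp
    then show ?thesis by (simp add: algebra_simps)
  qed
  finally have "2 * ((a + b) * (u + v)) \<le> 9 * (a * v)"
    using assms by simp
  then have "2 / 9 \<le> a * v / ((a + b) * (u + v))"
    using a assms by (simp add: pos_le_divide_eq add_pos_nonneg)
  then have "2 / 9 * (a * v - b * u) \<le> a * v / ((a + b) * (u + v)) * (a * v - b * u)"
    using True by (intro mult_right_mono) auto
  then show ?thesis
    by (simp add: eq)
next
  case False
  have "0 \<le> a * v * \<bar>a / (a + b) - u / (u + v)\<bar>"
    using assms by simp
  moreover have "2 / 9 * (a * v - b * u) \<le> 0"
    using False by simp
  ultimately show ?thesis
    by (rule order_trans[rotated])
qed

text \<open>If \<open>q x + q y = 0\<close>, the first quotient is 0 by convention; such an
  \<open>x\<close> has weight \<open>q x = 0\<close> in the averages below.\<close>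

definition pair_gap :: "(nat \<Rightarrow> real) \<Rightarrow> (nat \<Rightarrow> real) \<Rightarrow> nat \<Rightarrow> nat \<Rightarrow> real" where
  "pair_gap p q x y = \<bar>q x / (q x + q y) - p x / (p x + p y)\<bar>"

text \<open>Summing \<open>pair_ratio_bound\<close> over \<open>y\<close> bounds the row of
  \<open>x\<close> below by 2/9 of q(x) - (Q/P) p(x), where Q and P are the total weights of
  \<open>S\<close>. Rows are nonnegative, so only positive excesses matter; replacing Q/P by 1 costs
  p(x) max(0, Q/P - 1), in total max(0, Q - P).\<close>

lemma bucket_pair_gap:
  fixes p q :: "nat \<Rightarrow> real"
  assumes fin: "finite S" and q: "\<And>x. 0 \<le> q x"
    and p: "\<And>x. x \<in> S \<Longrightarrow> 0 < p x" and p2: "\<And>x y. x \<in> S \<Longrightarrow> y \<in> S \<Longrightarrow> p x \<le> 2 * p y"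
  shows "2 / 9 * ((\<Sum>x\<in>S. max 0 (q x - p x)) - max 0 (sum q S - sum p S))
    \<le> (\<Sum>x\<in>S. q x * (\<Sum>y\<in>S. p y / sum p S * pair_gap p q x y))"
proof (cases "S = {}")
  case False
  define Ps where "Ps = sum p S"
  define Qs where "Qs = sum q S"
  have Ps: "0 < Ps"
    unfolding Ps_def using fin False p by (intro sum_pos) auto
  have row: "2 / 9 * (max 0 (q x - p x) - p x * max 0 (Qs / Ps - 1))
      \<le> q x * (\<Sum>y\<in>S. p y / Ps * pair_gap p q x y)" if x: "x \<in> S" for x
  proof -
    have "2 / 9 * (q x - Qs / Ps * p x) = (\<Sum>y\<in>S. 2 / 9 * (q x * p y - q y * p x)) / Ps"
    proof -
      have "(\<Sum>y\<in>S. 2 / 9 * (q x * p y - q y * p x)) = 2 / 9 * (q x * Ps - Qs * p x)"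
        by (simp only: Ps_def Qs_def sum_distrib_left sum_distrib_right sum_subtractf right_diff_distrib)
      then show ?thesis
        by (simp only:) (use Ps in \<open>simp add: field_simps\<close>)
    qed
    also have "\<dots> \<le> (\<Sum>y\<in>S. q x * p y * pair_gap p q x y) / Ps"
      unfolding pair_gap_def using Ps x q p p2
      by (intro divide_right_mono sum_mono pair_ratio_bound) (auto simp: less_imp_le)
    also have "\<dots> = q x * (\<Sum>y\<in>S. p y / Ps * pair_gap p q x y)"
      by (simp add: sum_distrib_left sum_divide_distrib mult_ac)
    finally have le: "2 / 9 * (q x - Qs / Ps * p x) \<le> q x * (\<Sum>y\<in>S. p y / Ps * pair_gap p q x y)" .
    have nonneg: "0 \<le> q x * (\<Sum>y\<in>S. p y / Ps * pair_gap p q x y)"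
    proof -
      have "0 \<le> p y / Ps * pair_gap p q x y" if "y \<in> S" for y
        using p[OF that] Ps by (simp add: pair_gap_def)
      then show ?thesis
        by (rule mult_nonneg_nonneg[OF q sum_nonneg])
    qed
    show ?thesis
    proof (cases "q x \<le> p x")
      case True
      have "0 \<le> p x * max 0 (Qs / Ps - 1)"
        using p[OF x] by simp
      then show ?thesis using True nonneg by simp
    next
      case False
      have "p x * (Qs / Ps - 1) \<le> p x * max 0 (Qs / Ps - 1)"
        using p[OF x] by (intro mult_left_mono) auto
      then have "q x - p x - p x * max 0 (Qs / Ps - 1) \<le> q x - Qs / Ps * p x"
        by (simp add: algebra_simps)
      then show ?thesis using False le by simp
    qed
  qed
  have "Ps * max 0 (Qs / Ps - 1) = max 0 (Qs - Ps)"
    using Ps by (auto simp: max_def field_simps)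
  then have "2 / 9 * ((\<Sum>x\<in>S. max 0 (q x - p x)) - max 0 (Qs - Ps)) =
      (\<Sum>x\<in>S. 2 / 9 * (max 0 (q x - p x) - p x * max 0 (Qs / Ps - 1)))"
    by (simp only: sum_distrib_left[symmetric] sum_distrib_right[symmetric] sum_subtractf Ps_def)
  also have "\<dots> \<le> (\<Sum>x\<in>S. q x * (\<Sum>y\<in>S. p y / Ps * pair_gap p q x y))"
    by (intro sum_mono row)
  finally show ?thesis
    by (simp add: Ps_def Qs_def)
qed simp

lemma pair_gap_le_1: "(\<And>x. 0 \<le> p x) \<Longrightarrow> (\<And>x. 0 \<le> q x) \<Longrightarrow> pair_gap p q x y \<le> 1"
proof -
  assume "\<And>x. 0 \<le> p x" "\<And>x. 0 \<le> q x"
  moreover have "a / (a + b) \<in> {0..1}" if "0 \<le> a" "0 \<le> b" for a b :: real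
    using that by (auto simp: divide_le_eq_1)
  ultimately have "p x / (p x + p y) \<in> {0..1}" "q x / (q x + q y) \<in> {0..1}"
    by blast+
  then show ?thesis by (auto simp: pair_gap_def)
qed

text \<open>With \<open>h k\<close> the acceptance probability at scale \<open>k\<close>, a large
  gap is paid for by rejections. For the least \<open>k\<close> with 2^-k < f one has f \<le> 2 *
  2^-k, and the single term of scale \<open>k\<close> is already that large because 1 - h(k) \<ge>
  1/2.\<close>

lemma dyadic_bound:
  fixes f :: real and h :: "nat \<Rightarrow> real"
  assumes "f \<le> 1" "\<And>k. h k \<le> 1" and half: "\<And>k. k \<in> {1..K} \<Longrightarrow> (1 / 2) ^ k \<le> f \<Longrightarrow> h k \<le> 1 / 2"
  shows "f \<le> (1 / 2) ^ K + (\<Sum>k\<in>{1..K}. 4 * (1 / 2) ^ k * (1 - h k))"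
proof (cases "f \<le> (1 / 2) ^ K")
  case True
  have "0 \<le> (\<Sum>k\<in>{1..K}. 4 * (1 / 2) ^ k * (1 - h k))"
    using assms(2) by (intro sum_nonneg mult_nonneg_nonneg) auto
  then show ?thesis
    using True by (rule add_increasing2)
next
  case False
  define k where "k = (LEAST k. (1 / 2) ^ k < f)"
  have *: "(1 / 2) ^ K < f"
    using False by simp
  have k: "(1 / 2) ^ k < f"
    unfolding k_def using * by (rule LeastI)
  have kK: "k \<le> K"
    unfolding k_def using * by (rule Least_le)
  have "k \<noteq> 0"
    using k \<open>f \<le> 1\<close> by (cases k) auto
  then obtain l where l: "k = Suc l"
    by (cases k) auto
  have "\<not> (1 / 2) ^ l < f"
    using not_less_Least[of l "\<lambda>k. (1 / 2) ^ k < f"] l by (simp add: k_def)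
  then have "f \<le> 4 * (1 / 2) ^ k * (1 / 2)"
    by (simp add: l)
  also have "\<dots> \<le> 4 * (1 / 2) ^ k * (1 - h k)"
    using half[of k] k kK \<open>k \<noteq> 0\<close> by (intro mult_left_mono) auto
  also have "\<dots> \<le> (\<Sum>k\<in>{1..K}. 4 * (1 / 2) ^ k * (1 - h k))"
    using assms(2) kK \<open>k \<noteq> 0\<close>
    by (intro member_le_sum[of k _ "\<lambda>k. 4 * (1 / 2) ^ k * (1 - h k)"]) auto
  finally show ?thesis
    by (rule add_increasing[rotated]) simp
qed

subsection \<open>Random pairs within a bucket\<close>

text \<open>Bucket 0 collects the light points, which are never compared.\<close>

definition round_test :: "nat pmf \<Rightarrow> (nat \<Rightarrow> nat) \<Rightarrow> nat \<Rightarrow> real \<Rightarrow> tester" where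
  "round_test p \<beta> n \<tau> = Samp (\<lambda>x.
     if \<beta> x = 0 then Output Accept
     else Rand (cond_pmf p {y. \<beta> y = \<beta> x}) (\<lambda>y.
       if y = x then Output Accept else pair_test p n \<tau> x y))"

lemma measure_pmf_eq_sum:
  assumes "finite A" "set_pmf p \<subseteq> A"
  shows "measure_pmf.prob p S = sum (pmf p) {y \<in> A. y \<in> S}"
proof -
  have "measure_pmf.prob p S = measure_pmf.prob p {y \<in> A. y \<in> S}"
    using assms(2) by (intro measure_eq_AE) (auto simp: AE_measure_pmf_iff)
  also have "\<dots> = sum (pmf p) {y \<in> A. y \<in> S}"
    using assms(1) by (intro measure_measure_pmf_finite) auto
  finally show ?thesis .
qed

text \<open>The properties of the buckets on which the pair phase rests. By \<open>heavy\<close> and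
  \<open>supp\<close>, a point of non-zero index lies in the support of \<open>p\<close>, hence in
  {1..N}, so conditioning \<open>p\<close> on its bucket is meaningful.\<close>

locale bucketing =
  fixes N :: nat and p :: "nat pmf" and \<beta> :: "nat \<Rightarrow> nat" and B :: nat
  assumes supp: "set_pmf p \<subseteq> {1..N}"
    and heavy: "\<beta> x \<noteq> 0 \<Longrightarrow> 0 < pmf p x"
    and ratio: "\<beta> x \<noteq> 0 \<Longrightarrow> \<beta> x = \<beta> y \<Longrightarrow> pmf p x \<le> 2 * pmf p y"
    and range: "x \<in> {1..N} \<Longrightarrow> \<beta> x < B"
begin

definition bucket :: "nat \<Rightarrow> nat set" where
  "bucket j = {y \<in> {1..N}. \<beta> y = j}"

abbreviation partner_pmf :: "nat \<Rightarrow> nat pmf" where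
  "partner_pmf x \<equiv> cond_pmf p {y. \<beta> y = \<beta> x}"

lemma finite_bucket [simp]: "finite (bucket j)"
  by (simp add: bucket_def)

lemma pmf_map_bucket: "set_pmf D \<subseteq> {1..N} \<Longrightarrow> pmf (map_pmf \<beta> D) j = sum (pmf D) (bucket j)"
  by (simp add: pmf_map measure_pmf_eq_sum[of "{1..N}"] bucket_def)

lemma partner_nonempty:
  assumes "\<beta> x \<noteq> 0"
  shows "set_pmf p \<inter> {y. \<beta> y = \<beta> x} \<noteq> {}"
proof -
  have "x \<in> set_pmf p"
    using heavy[OF assms] by (simp add: set_pmf_iff)
  then show ?thesis by auto
qed

lemma set_partner_pmf: "\<beta> x \<noteq> 0 \<Longrightarrow> set_pmf (partner_pmf x) = set_pmf p \<inter> {y. \<beta> y = \<beta> x}"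
  by (rule set_cond_pmf[OF partner_nonempty])

lemma sum_partner_pmf:
  assumes "\<beta> x \<noteq> 0"
  shows "(\<Sum>y\<in>{1..N}. pmf (partner_pmf x) y * g y) =
    (\<Sum>y\<in>bucket (\<beta> x). pmf p y / sum (pmf p) (bucket (\<beta> x)) * g y)"
proof (rule sum.mono_neutral_cong_right)
  show "pmf (partner_pmf x) y * g y = pmf p y / sum (pmf p) (bucket (\<beta> x)) * g y"
    if "y \<in> bucket (\<beta> x)" for y
    using that supp
    by (simp add: pmf_cond[OF partner_nonempty[OF assms]] measure_pmf_eq_sum[of "{1..N}"] bucket_def)
qed (auto simp: bucket_def pmf_cond[OF partner_nonempty[OF assms]])

lemma sum_partner_pmf_eq_1: "\<beta> x \<noteq> 0 \<Longrightarrow> (\<Sum>y\<in>{1..N}. pmf (partner_pmf x) y) = 1"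
  using supp by (intro sum_pmf_eq_1) (auto simp: set_partner_pmf)

text \<open>The restriction to \<open>\<beta> x \<noteq> 0\<close> also avoids conditioning \<open>p\<close> on an event of mass 0.\<close>

definition pair_average :: "nat pmf \<Rightarrow> (nat \<Rightarrow> nat \<Rightarrow> real) \<Rightarrow> real" where
  "pair_average D g = (\<Sum>x\<in>{1..N}. pmf D x *
     (if \<beta> x = 0 then 0 else \<Sum>y\<in>{1..N}. pmf (partner_pmf x) y * g x y))"

text \<open>The comparison is asked only where \<open>D\<close> has mass at \<open>x\<close>:
  exactly there the law of a pair answer is determined by \<open>D\<close>.\<close>

lemma pair_average_mono:
  assumes "\<And>x y. pmf D x > 0 \<Longrightarrow> \<beta> x \<noteq> 0 \<Longrightarrow> y \<in> {1..N} \<Longrightarrow> \<beta> y = \<beta> x \<Longrightarrow> g x y \<le> h x y"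
  shows "pair_average D g \<le> pair_average D h"
  unfolding pair_average_def
proof (rule sum_mono)
  fix x assume "x \<in> {1..N}"
  show "pmf D x * (if \<beta> x = 0 then 0 else \<Sum>y\<in>{1..N}. pmf (partner_pmf x) y * g x y)
    \<le> pmf D x * (if \<beta> x = 0 then 0 else \<Sum>y\<in>{1..N}. pmf (partner_pmf x) y * h x y)"
  proof (cases "pmf D x = 0 \<or> \<beta> x = 0")
    case False
    then have D: "0 < pmf D x" and x: "\<beta> x \<noteq> 0"
      by (auto simp: pmf_pos)
    have "pmf (partner_pmf x) y * g x y \<le> pmf (partner_pmf x) y * h x y" if "y \<in> {1..N}" for y
    proof (cases "\<beta> y = \<beta> x")
      case True
      then show ?thesis
        using assms[OF D x that] by (intro mult_left_mono) auto
    qed (simp add: pmf_cond[OF partner_nonempty[OF x]])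
    then have "(\<Sum>y\<in>{1..N}. pmf (partner_pmf x) y * g x y)
        \<le> (\<Sum>y\<in>{1..N}. pmf (partner_pmf x) y * h x y)"
      by (rule sum_mono)
    then show ?thesis
      using x by (simp add: mult_left_mono)
  qed auto
qed

text \<open>Only an inequality, since the \<open>D\<close>-mass of bucket 0 is averaged with value
  0.\<close>

lemma pair_average_const:
  assumes "set_pmf D \<subseteq> {1..N}" "0 \<le> c"
  shows "pair_average D (\<lambda>_ _. c) \<le> c"
proof -
  have "pair_average D (\<lambda>_ _. c) \<le> (\<Sum>x\<in>{1..N}. pmf D x * c)"
    unfolding pair_average_def using assms(2) sum_partner_pmf_eq_1
    by (intro sum_mono mult_left_mono) (auto simp: sum_distrib_right[symmetric])
  also have "\<dots> = c"
    using assms(1) by (simp add: sum_distrib_right[symmetric] sum_pmf_eq_1)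
  finally show ?thesis .
qed

lemma pair_average_add:
  "pair_average D (\<lambda>x y. g x y + h x y) = pair_average D g + pair_average D h"
  unfolding pair_average_def sum.distrib[symmetric]
  by (intro sum.cong refl) (simp add: distrib_left sum.distrib)

lemma pair_average_cmult: "pair_average D (\<lambda>x y. c * g x y) = c * pair_average D g"
  unfolding pair_average_def sum_distrib_left
  by (intro sum.cong refl) (simp add: sum_distrib_left mult_ac)

lemma pair_average_sum:
  "pair_average D (\<lambda>x y. \<Sum>k\<in>I. g k x y) = (\<Sum>k\<in>I. pair_average D (g k))"
proof (induction I rule: infinite_finite_induct)
  case (insert k I)
  then show ?case by (simp add: pair_average_add)
qed (auto simp: pair_average_def intro!: sum.neutral)

abbreviation pair_accept ::
    "nat pmf \<Rightarrow> (nat \<Rightarrow> nat \<Rightarrow> nat pmf) \<Rightarrow> nat \<Rightarrow> real \<Rightarrow> nat \<Rightarrow> nat \<Rightarrow> real" where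
  "pair_accept D P n \<tau> x y \<equiv>
     accept_prob D P (if y = x then Output Accept else pair_test p n \<tau> x y)"

text \<open>Bucket 0 accepts outright, so the rejection probability is an average over pairs with
  the same weights as the average gap, and pointwise bounds carry over.\<close>

lemma reject_prob_round_test:
  assumes D: "set_pmf D \<subseteq> {1..N}"
  shows "1 - accept_prob D P (round_test p \<beta> n \<tau>) =
    pair_average D (\<lambda>x y. 1 - pair_accept D P n \<tau> x y)"
proof -
  let ?r = "\<lambda>x. if \<beta> x = 0 then 0 else \<Sum>y\<in>{1..N}. pmf (partner_pmf x) y * (1 - pair_accept D P n \<tau> x y)"
  have inner: "accept_prob D P (if \<beta> x = 0 then Output Accept else Rand (partner_pmf x) (\<lambda>y.
       if y = x then Output Accept else pair_test p n \<tau> x y)) = 1 - ?r x" for x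
  proof (cases "\<beta> x = 0")
    case False
    have "set_pmf (partner_pmf x) \<subseteq> {1..N}"
      using supp by (auto simp: set_partner_pmf[OF False])
    then have "accept_prob D P (Rand (partner_pmf x) (\<lambda>y.
       if y = x then Output Accept else pair_test p n \<tau> x y)) =
       (\<Sum>y\<in>{1..N}. pmf (partner_pmf x) y * pair_accept D P n \<tau> x y)"
      unfolding run.simps by (intro pmf_bind_finite) auto
    then show ?thesis
      using False sum_partner_pmf_eq_1[OF False] by (simp add: right_diff_distrib sum_subtractf)
  qed simp
  have "accept_prob D P (round_test p \<beta> n \<tau>) = (\<Sum>x\<in>{1..N}. pmf D x * (1 - ?r x))"
    unfolding round_test_def run.simps(2) using D
    by (subst pmf_bind_finite[of "{1..N}"]) (simp_all only: inner finite_atLeastAtMost)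
  also have "\<dots> = (\<Sum>x\<in>{1..N}. pmf D x) - (\<Sum>x\<in>{1..N}. pmf D x * ?r x)"
    by (simp only: right_diff_distrib sum_subtractf mult_1_right)
  also have "(\<Sum>x\<in>{1..N}. pmf D x) = 1"
    using D by (intro sum_pmf_eq_1) auto
  finally show ?thesis
    by (simp only: pair_average_def)
qed

lemma legal_queries_round_test: "legal_queries N (round_test p \<beta> n \<tau>)"
  using supp
  by (auto simp: round_test_def pair_test_def set_partner_pmf intro!: legal_queries_count_pcond)

lemma queries_le_round_test: "queries_le N (round_test p \<beta> n \<tau>) (Suc n)"
proof -
  have "queries_le N (pair_test p n \<tau> x y) (n + 0)" for x y
    unfolding pair_test_def by (intro queries_le_count_pcond) simp
  then show ?thesis
    by (simp add: round_test_def)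
qed

lemma round_test_complete:
  assumes P: "pcond_for N p P" and "0 < n" "0 \<le> \<tau>"
  shows "accept_prob p P (round_test p \<beta> n \<tau>) \<ge> 1 - 2 * exp (- 2 * real n * \<tau>\<^sup>2)"
proof -
  let ?\<eta> = "2 * exp (- 2 * real n * \<tau>\<^sup>2)"
  have "1 - accept_prob p P (round_test p \<beta> n \<tau>) = pair_average p (\<lambda>x y. 1 - pair_accept p P n \<tau> x y)"
    by (rule reject_prob_round_test[OF supp])
  also have "\<dots> \<le> pair_average p (\<lambda>_ _. ?\<eta>)"
  proof (rule pair_average_mono)
    fix x y assume xy: "0 < pmf p x" "y \<in> {1..N}"
    then have "x \<in> set_pmf p"
      by (simp add: set_pmf_iff)
    then have "x \<in> {1..N}"
      using supp by blast
    with xy P have "pmf (P x y) x = pmf p x / (pmf p x + pmf p y)" if "y \<noteq> x"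
      using that by (auto simp: pcond_for_def add_pos_nonneg)
    then show "1 - pair_accept p P n \<tau> x y \<le> ?\<eta>"
      using pair_test_complete[OF assms(2,3), of P x y p p] by (cases "y = x") auto
  qed
  also have "\<dots> \<le> ?\<eta>"
    by (rule pair_average_const[OF supp]) simp
  finally show ?thesis by simp
qed

text \<open>The total variation distance is the sum of the positive parts of D - p, split here by
  buckets. Errors of the bucket weights cost at most \<epsilon>/2, the light bucket at most
  \<epsilon>/8 more, and \<open>bucket_pair_gap\<close> turns the rest into a gap of 2/9 * 3/8 *
  \<epsilon> = \<epsilon>/12.\<close>

lemma pair_average_gap_ge:
  assumes D: "set_pmf D \<subseteq> {1..N}"
    and light: "(\<Sum>x\<in>bucket 0. pmf p x) \<le> \<epsilon> / 8"
    and far: "d_TV N D p \<ge> \<epsilon>"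
    and close: "(\<Sum>j<B. \<bar>pmf (map_pmf \<beta> D) j - pmf (map_pmf \<beta> p) j\<bar>) \<le> \<epsilon>"
  shows "\<epsilon> / 12 \<le> pair_average D (pair_gap (pmf p) (pmf D))"
proof -
  let ?q = "pmf D" and ?p = "pmf p"
  define Q where "Q j = sum ?q (bucket j)" for j
  define R where "R j = sum ?p (bucket j)" for j
  have max_eq: "max 0 (a - b) = (\<bar>a - b\<bar> + (a - b)) / 2" for a b :: real
    by (simp add: max_def)
  have by_bucket: "(\<Sum>x\<in>{1..N}. g x) = (\<Sum>j<B. \<Sum>x\<in>bucket j. g x)" for g :: "nat \<Rightarrow> real"
    unfolding bucket_def using range by (subst sum.group[of "{1..N}" "{..<B}" \<beta>]) auto
  have tot: "sum ?q {1..N} = 1" "sum ?p {1..N} = 1"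
    using D supp by (auto intro!: sum_pmf_eq_1)
  have "(\<Sum>x\<in>{1..N}. max 0 (?q x - ?p x)) = d_TV N D p"
    unfolding max_eq d_TV_def sum_divide_distrib[symmetric] sum.distrib sum_subtractf tot by simp
  with far have far': "\<epsilon> \<le> (\<Sum>j<B. \<Sum>x\<in>bucket j. max 0 (?q x - ?p x))"
    unfolding by_bucket[symmetric] by simp
  have totB: "(\<Sum>j<B. Q j) = 1" "(\<Sum>j<B. R j) = 1"
    unfolding Q_def R_def by_bucket[symmetric] tot by simp_all
  \<comment> \<open>Both weight vectors sum to 1, so the positive parts make up half of the absolute
    differences.\<close>
  have "(\<Sum>j<B. max 0 (Q j - R j)) = (\<Sum>j<B. \<bar>Q j - R j\<bar>) / 2"
    unfolding max_eq sum_divide_distrib[symmetric] sum.distrib sum_subtractf totB by simp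
  also have "\<dots> \<le> \<epsilon> / 2"
    using close D supp by (simp add: pmf_map_bucket Q_def R_def)
  finally have close': "(\<Sum>j<B. max 0 (Q j - R j)) \<le> \<epsilon> / 2" .
  have "0 < B"
    using totB by (cases B) auto
  define E where "E j = (\<Sum>x\<in>bucket j. max 0 (?q x - ?p x))" for j
  define T where "T j = (if j = 0 then 0
    else \<Sum>x\<in>bucket j. ?q x * (\<Sum>y\<in>bucket j. ?p y / R j * pair_gap ?p ?q x y))" for j
  have "2 / 9 * (E j - max 0 (Q j - R j) - (if j = 0 then \<epsilon> / 8 else 0)) \<le> T j" for j
  proof (cases "j = 0")
    case True
    \<comment> \<open>Bucket 0 yields no gap, so its whole excess is written off against its
      \<open>D\<close>-mass.\<close>
    have "(\<Sum>x\<in>bucket 0. max 0 (?q x - ?p x)) \<le> Q 0"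
      unfolding Q_def by (intro sum_mono) auto
    also have "\<dots> \<le> \<epsilon> / 8 + max 0 (Q 0 - R 0)"
      using light by (simp add: R_def)
    finally show ?thesis
      using True by (simp add: T_def E_def)
  next
    case False
    have "2 / 9 * ((\<Sum>x\<in>bucket j. max 0 (?q x - ?p x)) - max 0 (sum ?q (bucket j) - sum ?p (bucket j)))
      \<le> (\<Sum>x\<in>bucket j. ?q x * (\<Sum>y\<in>bucket j. ?p y / sum ?p (bucket j) * pair_gap ?p ?q x y))"
      by (rule bucket_pair_gap) (use False in \<open>auto simp: bucket_def intro: heavy ratio\<close>)
    then show ?thesis
      using False by (simp add: T_def E_def Q_def R_def)
  qed
  then have le: "(\<Sum>j<B. 2 / 9 * (E j - max 0 (Q j - R j) - (if j = 0 then \<epsilon> / 8 else 0)))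
      \<le> (\<Sum>j<B. T j)"
    by (intro sum_mono) auto
  have eq: "(\<Sum>j<B. 2 / 9 * (E j - max 0 (Q j - R j) - (if j = 0 then \<epsilon> / 8 else 0))) =
    2 / 9 * ((\<Sum>j<B. E j) - (\<Sum>j<B. max 0 (Q j - R j)) - \<epsilon> / 8)"
    using \<open>0 < B\<close> by (simp only: sum_distrib_left[symmetric] sum_subtractf) simp
  have "2 / 9 * (\<epsilon> - \<epsilon> / 2 - \<epsilon> / 8) \<le>
    2 / 9 * ((\<Sum>j<B. E j) - (\<Sum>j<B. max 0 (Q j - R j)) - \<epsilon> / 8)"
    using far' close' unfolding E_def by (intro mult_left_mono diff_mono) auto
  also note eq[symmetric]
  also note le
  also have "(\<Sum>j<B. T j) = (\<Sum>j<B. \<Sum>x\<in>bucket j. ?q x *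
      (if \<beta> x = 0 then 0 else \<Sum>y\<in>{1..N}. pmf (partner_pmf x) y * pair_gap ?p ?q x y))"
  proof (rule sum.cong[OF refl])
    fix j assume "j \<in> {..<B}"
    show "T j = (\<Sum>x\<in>bucket j. ?q x *
        (if \<beta> x = 0 then 0 else \<Sum>y\<in>{1..N}. pmf (partner_pmf x) y * pair_gap ?p ?q x y))"
    proof (cases "j = 0")
      case True
      then show ?thesis by (simp add: T_def bucket_def)
    next
      case False
      have "(\<Sum>y\<in>{1..N}. pmf (partner_pmf x) y * pair_gap ?p ?q x y) =
        (\<Sum>y\<in>bucket j. ?p y / R j * pair_gap ?p ?q x y)" if "x \<in> bucket j" for x
        using that False sum_partner_pmf[of x "pair_gap ?p ?q x"] by (simp add: bucket_def R_def)
      then show ?thesis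
        unfolding T_def using False by (auto simp: bucket_def intro!: sum.cong)
    qed
  qed
  also have "\<dots> = pair_average D (pair_gap ?p ?q)"
    unfolding pair_average_def by (rule by_bucket[symmetric])
  finally show ?thesis
    by simp
qed

end

subsection \<open>All dyadic scales\<close>

text \<open>Scale \<open>k\<close> looks for gaps of 2^-k, twice the tolerance. The number of
  queries makes the Hoeffding exponent 7 + 3K at every scale; the number of rounds is the inverse,
  up to a constant, of the rejection probability that some scale must have when the average gap is
  about 2^-K.\<close>

definition round_block :: "nat pmf \<Rightarrow> (nat \<Rightarrow> nat) \<Rightarrow> nat \<Rightarrow> nat \<Rightarrow> tester" where
  "round_block p \<beta> K k = all_testers (replicate (5 * K * 2 ^ (K - k))
     (round_test p \<beta> (4 ^ k * (14 + 6 * K)) ((1 / 2) ^ k / 2)))"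

definition pair_phase :: "nat pmf \<Rightarrow> (nat \<Rightarrow> nat) \<Rightarrow> nat \<Rightarrow> tester" where
  "pair_phase p \<beta> K = all_testers (map (round_block p \<beta> K) [1..<Suc K])"

lemma deviation_exponent:
  "2 * exp (- 2 * real (4 ^ k * (14 + 6 * K)) * ((1 / 2) ^ k / 2)\<^sup>2) = 2 * exp (- real (7 + 3 * K))"
proof -
  have "(4::real) ^ k * ((1 / 2) ^ k)\<^sup>2 = 1"
    by (simp add: power2_eq_square power_mult_distrib[symmetric])
  then have "2 * real (4 ^ k * (14 + 6 * K)) * ((1 / 2) ^ k / 2)\<^sup>2 = real (7 + 3 * K)"
    by (simp add: power_divide algebra_simps)
  then show ?thesis by simp
qed

text \<open>The factor 8^K pays for the union bound: there are at most 5 K^2 2^K \<le> 5 * 8^K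
  rounds in all, failing with total probability at most 5/64.\<close>

lemma deviation_le: "2 * exp (- real (7 + 3 * K)) \<le> 1 / (64 * 8 ^ K)"
proof -
  have "(2::real) ^ (7 + 3 * K) \<le> exp 1 ^ (7 + 3 * K)"
    using exp_ge_add_one_self[of 1] by (intro power_mono) auto
  also have "\<dots> = exp (real (7 + 3 * K))"
    by (simp add: exp_of_nat_mult[symmetric])
  finally have "1 / exp (real (7 + 3 * K)) \<le> 1 / 2 ^ (7 + 3 * K)"
    by (intro frac_le) auto
  then have "exp (- real (7 + 3 * K)) \<le> 1 / 2 ^ (7 + 3 * K)"
    by (simp only: exp_minus inverse_eq_divide)
  also have "(2::real) ^ (7 + 3 * K) = 128 * 8 ^ K"
    by (simp add: power_add power_mult)
  finally show ?thesis by simp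
qed

context bucketing
begin

lemma pair_phase_complete:
  assumes "pcond_for N p P"
  shows "accept_prob p P (pair_phase p \<beta> K) \<ge> 9 / 10"
proof -
  define \<eta> where "\<eta> = 2 * exp (- real (7 + 3 * K))"
  have "accept_prob p P (round_block p \<beta> K k) \<ge> 1 - 5 * K * 2 ^ K * \<eta>" for k
  proof -
    have "1 - \<eta> \<le> accept_prob p P (round_test p \<beta> (4 ^ k * (14 + 6 * K)) ((1 / 2) ^ k / 2))"
      using round_test_complete[OF assms, of "4 ^ k * (14 + 6 * K)" "(1 / 2) ^ k / 2"]
      unfolding \<eta>_def deviation_exponent by simp
    then have "accept_prob p P (round_block p \<beta> K k) \<ge>
        1 - length (replicate (5 * K * 2 ^ (K - k))
          (round_test p \<beta> (4 ^ k * (14 + 6 * K)) ((1 / 2) ^ k / 2))) * \<eta>"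
      unfolding round_block_def by (intro accept_prob_all_testers_ge) auto
    moreover have "real (5 * K * 2 ^ (K - k)) * \<eta> \<le> 5 * K * 2 ^ K * \<eta>"
      by (intro mult_right_mono) (auto simp: \<eta>_def intro!: mult_left_mono power_increasing)
    ultimately show ?thesis by simp
  qed
  then have "accept_prob p P (pair_phase p \<beta> K) \<ge>
      1 - length (map (round_block p \<beta> K) [1..<Suc K]) * (5 * K * 2 ^ K * \<eta>)"
    unfolding pair_phase_def by (intro accept_prob_all_testers_ge) auto
  then have "accept_prob p P (pair_phase p \<beta> K) \<ge> 1 - K * (5 * K * 2 ^ K * \<eta>)"
    by (simp del: upt_Suc)
  moreover have "K * (5 * K * 2 ^ K * \<eta>) \<le> 1 / 10"
  proof -
    have K: "real K \<le> 2 ^ K"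
      using of_nat_less_two_power[of K, where 'a = real] by simp
    have "K * (5 * K * 2 ^ K * \<eta>) \<le> 2 ^ K * (5 * 2 ^ K * 2 ^ K * (1 / (64 * 8 ^ K)))"
      using K deviation_le[of K] by (intro mult_mono) (auto simp: \<eta>_def)
    also have "\<dots> = 5 / 64 * ((2 ^ K * 2 ^ K * 2 ^ K) / 8 ^ K)"
      by simp
    also have "(2::real) ^ K * 2 ^ K * 2 ^ K = 8 ^ K"
      by (simp add: power_mult_distrib[symmetric])
    also have "5 / 64 * ((8::real) ^ K / 8 ^ K) \<le> 1 / 10"
      by simp
    finally show ?thesis .
  qed
  ultimately show ?thesis by linarith
qed

text \<open>Averaging \<open>dyadic_bound\<close> over the pairs bounds the average gap by 2^-K plus
  a weighted sum of the rejection probabilities \<open>\<rho> k\<close>. Since 2^-K uses up at most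
  half of \<mu>, some scale has a large \<open>\<rho> k\<close>, and its repeated rounds
  reject.\<close>

lemma pair_phase_sound:
  assumes D: "set_pmf D \<subseteq> {1..N}" and P: "pcond_for N D P"
    and gap: "\<mu> \<le> pair_average D (pair_gap (pmf p) (pmf D))" and K: "2 / \<mu> \<le> 2 ^ K" and "0 < \<mu>"
  shows "accept_prob D P (pair_phase p \<beta> K) \<le> 1 / 3"
proof -
  let ?n = "\<lambda>k. 4 ^ k * (14 + 6 * K)" and ?\<tau> = "\<lambda>k. (1 / 2) ^ k / 2 :: real"
  define \<rho> where "\<rho> k = 1 - accept_prob D P (round_test p \<beta> (?n k) (?\<tau> k))" for k
  have "pair_average D (pair_gap (pmf p) (pmf D)) \<le> pair_average D (\<lambda>x y.
      (1 / 2) ^ K + (\<Sum>k\<in>{1..K}. 4 * (1 / 2) ^ k * (1 - pair_accept D P (?n k) (?\<tau> k) x y)))"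
  proof (rule pair_average_mono)
    fix x y assume x: "0 < pmf D x" "\<beta> x \<noteq> 0" and y: "y \<in> {1..N}" "\<beta> y = \<beta> x"
    have "x \<in> set_pmf D"
      using x by (simp add: set_pmf_iff)
    then have "x \<in> {1..N}"
      using D by blast
    show "pair_gap (pmf p) (pmf D) x y
      \<le> (1 / 2) ^ K + (\<Sum>k\<in>{1..K}. 4 * (1 / 2) ^ k * (1 - pair_accept D P (?n k) (?\<tau> k) x y))"
    proof (rule dyadic_bound)
      show "pair_gap (pmf p) (pmf D) x y \<le> 1"
        by (rule pair_gap_le_1) auto
      fix k :: nat
      show "pair_accept D P (?n k) (?\<tau> k) x y \<le> 1"
        by (rule pmf_le_1)
      assume k: "(1 / 2) ^ k \<le> pair_gap (pmf p) (pmf D) x y"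
      \<comment> \<open>A point compared with itself has both ratios equal to 1/2, hence gap
        0.\<close>
      have "x \<noteq> y"
      proof
        assume "x = y"
        then have "pair_gap (pmf p) (pmf D) x y = 0"
          using x heavy[OF x(2)] by (simp add: pair_gap_def)
        with k show False
          by (metis not_le zero_less_divide_1_iff zero_less_numeral zero_less_power)
      qed
      then have "pmf (P x y) x = pmf D x / (pmf D x + pmf D y)"
        using P \<open>x \<in> {1..N}\<close> y x by (auto simp: pcond_for_def add_pos_nonneg)
      then have "accept_prob D P (pair_test p (?n k) (?\<tau> k) x y) \<le> 2 * exp (- real (7 + 3 * K))"
        using pair_test_sound[of "?n k" "?\<tau> k" P x y p D] k
        unfolding deviation_exponent pair_gap_def by simp
      also have "\<dots> \<le> 1 / (64 * 8 ^ K)"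
        by (rule deviation_le)
      also have "\<dots> \<le> 1 / 2"
        using one_le_power[of "8::real" K] by (intro frac_le; linarith)
      finally show "pair_accept D P (?n k) (?\<tau> k) x y \<le> 1 / 2"
        using \<open>x \<noteq> y\<close> by simp
    qed
  qed
  also have "\<dots> = pair_average D (\<lambda>_ _. (1 / 2) ^ K) + (\<Sum>k\<in>{1..K}. 4 * (1 / 2) ^ k * \<rho> k)"
    by (simp only: pair_average_add pair_average_sum pair_average_cmult
        reject_prob_round_test[OF D, symmetric] \<rho>_def)
  also have "pair_average D (\<lambda>_ _. (1 / 2) ^ K) \<le> (1 / 2) ^ K"
    by (rule pair_average_const[OF D]) simp
  also have "(1 / 2) ^ K \<le> \<mu> / 2"
    using K \<open>0 < \<mu>\<close> by (simp add: power_divide field_simps)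
  finally have sum_ge: "\<mu> / 2 \<le> (\<Sum>k\<in>{1..K}. 4 * (1 / 2) ^ k * \<rho> k)"
    using gap by linarith
  have "0 < K"
    using sum_ge \<open>0 < \<mu>\<close> by (cases K) auto
  \<comment> \<open>Pigeonhole: one of the \<open>K\<close> terms is at least their average.\<close>
  have "\<exists>k\<in>{1..K}. \<mu> / (2 * K) \<le> 4 * (1 / 2) ^ k * \<rho> k"
  proof (rule ccontr)
    assume "\<not> ?thesis"
    then have "(\<Sum>k\<in>{1..K}. 4 * (1 / 2) ^ k * \<rho> k) < (\<Sum>k\<in>{1..K}. \<mu> / (2 * K))"
      using \<open>0 < K\<close> by (intro sum_strict_mono) (auto simp: not_le)
    with sum_ge \<open>0 < K\<close> show False by simp
  qed
  then obtain k where k: "k \<in> {1..K}" and \<rho>: "\<mu> / (2 * K) \<le> 4 * (1 / 2) ^ k * \<rho> k"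
    by blast
  define M where "M = 5 * K * 2 ^ (K - k)"
  have "5 / 4 \<le> real M * \<rho> k"
  proof -
    have "(2::real) ^ (K - k) * 2 ^ k = 2 ^ K"
      using k by (simp add: power_add[symmetric])
    then have M: "real M * 2 ^ k = 5 * K * 2 ^ K"
      by (simp add: M_def)
    \<comment> \<open>With \<open>\<rho> k\<close> at least 2^k \<mu> / (8K), the expected number of
      rejecting rounds is at least 5/8 * 2^K \<mu>, and 2^K \<mu> \<ge> 2.\<close>
    have "5 / 4 * 2 \<le> 5 / 4 * (2 ^ K * \<mu>)"
      using K \<open>0 < \<mu>\<close> by (simp add: field_simps)
    also have "\<dots> = real M * 2 ^ k / 2 * (\<mu> / (2 * K))"
      unfolding M using \<open>0 < K\<close> by simp
    also have "\<dots> \<le> real M * 2 ^ k / 2 * (4 * (1 / 2) ^ k * \<rho> k)"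
      by (intro mult_left_mono \<rho>) auto
    also have "\<dots> = 2 * (real M * \<rho> k)"
      by (simp add: power_divide)
    finally show ?thesis by simp
  qed
  \<comment> \<open>The quadratic Taylor sum 1 + 5/4 + 25/32 already exceeds 3.\<close>
  have "(3::real) \<le> exp (5 / 4)"
    using exp_lower_Taylor_quadratic[of "5 / 4"] by (simp add: power2_eq_square)
  then have exp_le: "exp (- (5 / 4 :: real)) \<le> 1 / 3"
    by (simp add: exp_minus field_simps)
  have "accept_prob D P (pair_phase p \<beta> K) \<le>
      accept_prob D P (round_block p \<beta> K k)"
    unfolding pair_phase_def using k by (intro accept_prob_all_testers_le) (auto simp del: upt_Suc)
  also have "\<dots> = (1 - \<rho> k) ^ M"
    by (simp add: round_block_def accept_prob_all_testers_replicate \<rho>_def M_def)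
  also have "\<dots> \<le> exp (- \<rho> k) ^ M"
    using exp_ge_add_one_self[of "- \<rho> k"] by (intro power_mono) (auto simp: \<rho>_def)
  also have "\<dots> = exp (- (real M * \<rho> k))"
    by (simp add: exp_of_nat_mult[symmetric])
  also have "\<dots> \<le> exp (- (5 / 4))"
    using \<open>5 / 4 \<le> real M * \<rho> k\<close> by simp
  finally show ?thesis
    using exp_le by linarith
qed

lemma legal_queries_pair_phase: "legal_queries N (pair_phase p \<beta> K)"
  unfolding pair_phase_def round_block_def
  by (auto intro!: legal_queries_all_testers legal_queries_round_test)

text \<open>Finer scales spend 4^k queries per pair but only 2^(K - k) rounds, so each scale stays
  below 4^K up to the other factors. The step from 14 to 15 absorbs the sample that opens a
  round.\<close>

lemma queries_le_pair_phase: "queries_le N (pair_phase p \<beta> K) (K * (5 * K * 4 ^ K * (15 + 6 * K)))"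
proof -
  have "queries_le N (round_block p \<beta> K k) (5 * K * 4 ^ K * (15 + 6 * K))"
    if "k \<le> K" for k
    unfolding round_block_def
  proof (rule queries_le_mono)
    let ?t = "round_test p \<beta> (4 ^ k * (14 + 6 * K)) ((1 / 2) ^ k / 2)"
    have "queries_le N (all_testers (replicate (5 * K * 2 ^ (K - k)) ?t))
      (length (replicate (5 * K * 2 ^ (K - k)) ?t) * Suc (4 ^ k * (14 + 6 * K)))"
      by (intro queries_le_all_testers) (auto intro: queries_le_round_test)
    then show "queries_le N (all_testers (replicate (5 * K * 2 ^ (K - k)) ?t))
      (5 * K * 2 ^ (K - k) * Suc (4 ^ k * (14 + 6 * K)))"
      by simp
    have "2 ^ (K - k) * Suc (4 ^ k * (14 + 6 * K)) \<le> 4 ^ (K - k) * (4 ^ k * (15 + 6 * K))"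
      using one_le_power[of "4::nat" k] by (intro mult_mono power_mono) (auto simp: algebra_simps)
    also have "\<dots> = 4 ^ K * (15 + 6 * K)"
      using that by (simp add: power_add[symmetric])
    finally show "5 * K * 2 ^ (K - k) * Suc (4 ^ k * (14 + 6 * K)) \<le> 5 * K * 4 ^ K * (15 + 6 * K)"
      by (simp only: mult.assoc mult_le_mono)
  qed
  then have "queries_le N (pair_phase p \<beta> K)
    (length (map (round_block p \<beta> K) [1..<Suc K]) * (5 * K * 4 ^ K * (15 + 6 * K)))"
    unfolding pair_phase_def by (intro queries_le_all_testers) auto
  then show ?thesis by (simp del: upt_Suc)
qed

end

subsection \<open>The identity tester\<close>

text \<open>A point above \<delta> with exponent j has mass at least 2^-j and, for j > 0, below 2 *
  2^-j. The shift by \<open>Suc\<close> reserves index 0 for the light points.\<close>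

definition mass_bucket :: "nat pmf \<Rightarrow> real \<Rightarrow> nat \<Rightarrow> nat" where
  "mass_bucket p \<delta> i = (if pmf p i \<le> \<delta> then 0 else Suc (LEAST j. 1 \<le> 2 ^ j * pmf p i))"

lemma bucketing_mass_bucket:
  assumes supp: "set_pmf p \<subseteq> {1..N}" and "0 < \<delta>" and J: "1 / \<delta> \<le> 2 ^ J"
  shows "bucketing N p (mass_bucket p \<delta>) (J + 2)"
proof
  define least where "least i = (LEAST j. 1 \<le> 2 ^ j * pmf p i)" for i
  have JI: "1 \<le> 2 ^ J * pmf p i" if "pmf p i > \<delta>" for i
  proof -
    have "1 \<le> 2 ^ J * \<delta>"
      using J \<open>0 < \<delta>\<close> by (simp add: field_simps)
    also have "\<dots> \<le> 2 ^ J * pmf p i"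
      using that by (intro mult_left_mono) auto
    finally show ?thesis .
  qed
  have least: "1 \<le> 2 ^ least i * pmf p i" "least i \<le> J" if "pmf p i > \<delta>" for i
    unfolding least_def using JI[OF that] by (rule LeastI, rule Least_le)
  have below: "2 ^ l * pmf p i < 1" if "least i = Suc l" for i l
    using not_less_Least[of l "\<lambda>j. 1 \<le> 2 ^ j * pmf p i"] that by (simp add: least_def)
  show "set_pmf p \<subseteq> {1..N}"
    by fact
  show "0 < pmf p x" if "mass_bucket p \<delta> x \<noteq> 0" for x
    using that \<open>0 < \<delta>\<close> by (auto simp: mass_bucket_def split: if_splits)
  \<comment> \<open>The exponents 0 to \<open>J\<close> and the light bucket take up
    \<open>J + 2\<close> indices.\<close>
  show "mass_bucket p \<delta> x < J + 2" for x
    using least(2)[of x] by (auto simp: mass_bucket_def least_def)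
  show "pmf p x \<le> 2 * pmf p y"
    if "mass_bucket p \<delta> x \<noteq> 0" "mass_bucket p \<delta> x = mass_bucket p \<delta> y" for x y
  proof -
    have y: "\<delta> < pmf p y" and eq: "least x = least y"
      using that by (auto simp: mass_bucket_def least_def split: if_splits)
    show ?thesis
    proof (cases "least y")
      case 0
      then show ?thesis
        using least(1)[OF y] pmf_le_1[of p x] by simp
    next
      case (Suc l)
      have "2 ^ l * pmf p x \<le> 2 ^ l * (2 * pmf p y)"
      proof -
        have "2 ^ l * pmf p x < 1"
          using below[of x l] eq Suc by simp
        also have "1 \<le> 2 ^ l * (2 * pmf p y)"
          using least(1)[OF y] Suc by (simp add: mult_ac)
        finally show ?thesis by (rule less_imp_le)
      qed
      then show ?thesis by simp
    qed
  qed
qed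

lemma sum_light_bucket_le:
  fixes N :: nat and \<delta> :: real
  assumes "0 < \<delta>"
  shows "(\<Sum>x\<in>{y \<in> {1..N}. mass_bucket p \<delta> y = 0}. pmf p x) \<le> N * \<delta>"
proof -
  let ?S = "{y \<in> {1..N}. mass_bucket p \<delta> y = 0}"
  have "(\<Sum>x\<in>?S. pmf p x) \<le> card ?S * \<delta>"
    by (rule sum_bounded_above) (auto simp: mass_bucket_def split: if_splits)
  also have "card ?S \<le> card {1..N}"
    by (rule card_mono) auto
  then have "card ?S * \<delta> \<le> N * \<delta>"
    using assms by (intro mult_right_mono) auto
  finally show ?thesis .
qed

section \<open>Rounded binary logarithms\<close>

lemma ceiling_log2_bounds:
  assumes "1 \<le> (a::real)"
  defines "k \<equiv> nat \<lceil>log 2 a\<rceil>"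
  shows "a \<le> 2 ^ k" "2 ^ k \<le> 2 * a" "real k \<le> log 2 a + 1"
proof -
  have log: "0 \<le> log 2 a"
    using assms by simp
  then have k: "log 2 a \<le> real k" "real k \<le> log 2 a + 1"
    unfolding k_def by linarith+
  show "real k \<le> log 2 a + 1" by fact
  have "a = 2 powr log 2 a"
    using assms by simp
  also have "\<dots> \<le> 2 powr real k"
    using k by (intro powr_mono) auto
  finally show "a \<le> 2 ^ k"
    by (simp add: powr_realpow)
  have "(2::real) ^ k = 2 powr real k"
    by (simp add: powr_realpow)
  also have "\<dots> \<le> 2 powr (log 2 a + 1)"
    using k by (intro powr_mono) auto
  also have "\<dots> = 2 * a"
    using assms by (simp add: powr_add)
  finally show "2 ^ k \<le> 2 * a" .
qed

lemma log2_le: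
  assumes "1 \<le> (a::real)"
  shows "log 2 a \<le> 2 * ln a"
proof -
  have "ln a / ln 2 \<le> ln a / (1 / 2)"
    using assms ln2_ge_two_thirds by (intro divide_left_mono) auto
  then show ?thesis by (simp add: log_def)
qed

section \<open>Assembly of the two phases and the query count\<close>

text \<open>The cutoff \<delta> keeps the light mass below \<epsilon>/8, and 2^K \<ge> 24/\<epsilon>
  = 2/(\<epsilon>/12) fits the gap left by \<open>pair_average_gap_ge\<close>. The case N \<le> 1 is
  split off because the query bound is then 0.\<close>

definition identity_tester :: "nat \<Rightarrow> nat pmf \<Rightarrow> real \<Rightarrow> tester" where
  "identity_tester N p \<epsilon> =
    (let \<delta> = \<epsilon> / (8 * N); \<beta> = mass_bucket p \<delta>; B = nat \<lceil>log 2 (1 / \<delta>)\<rceil> + 2;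
         m = nat \<lceil>100 * sqrt B / \<epsilon>\<^sup>2\<rceil>; K = nat \<lceil>log 2 (24 / \<epsilon>)\<rceil>
     in if N \<le> 1 then Output Accept
        else conj_tester (bucket_test p \<beta> B m (\<epsilon>\<^sup>2 / 2)) (pair_phase p \<beta> K))"

context
  fixes N :: nat and p :: "nat pmf" and \<epsilon> :: real
  assumes N: "2 \<le> N" and supp: "set_pmf p \<subseteq> {1..N}" and \<epsilon>: "0 < \<epsilon>" "\<epsilon> < 1"
begin

private definition "\<delta> = \<epsilon> / (8 * N)"
private definition "\<beta> = mass_bucket p \<delta>"
private definition "J = nat \<lceil>log 2 (1 / \<delta>)\<rceil>"
private definition "m = nat \<lceil>100 * sqrt (J + 2) / \<epsilon>\<^sup>2\<rceil>"
private definition "K = nat \<lceil>log 2 (24 / \<epsilon>)\<rceil>"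

private lemma identity_tester_eq:
  "identity_tester N p \<epsilon> = conj_tester (bucket_test p \<beta> (J + 2) m (\<epsilon>\<^sup>2 / 2)) (pair_phase p \<beta> K)"
  using N by (simp add: identity_tester_def Let_def \<delta>_def \<beta>_def J_def m_def K_def)

private lemma \<delta>: "0 < \<delta>" "1 \<le> 1 / \<delta>"
  using N \<epsilon> by (auto simp: \<delta>_def field_simps)

interpretation bucketing N p \<beta> "J + 2"
  unfolding \<beta>_def by (rule bucketing_mass_bucket[OF supp \<delta>(1)]) (simp add: J_def ceiling_log2_bounds(1) \<delta>)

private lemma m_ge: "100 * sqrt (real (J + 2)) / \<epsilon>\<^sup>2 \<le> real m"
  unfolding m_def by (rule of_nat_ceiling)

private lemma \<beta>_image: "set_pmf D \<subseteq> {1..N} \<Longrightarrow> \<beta> ` set_pmf D \<subseteq> {..<J + 2}"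
  using range by blast

lemma legal_queries_identity_tester: "legal_queries N (identity_tester N p \<epsilon>)"
  unfolding identity_tester_eq
  by (intro legal_queries_conj_tester legal_queries_bucket_test legal_queries_pair_phase)

lemma identity_tester_complete:
  assumes "pcond_for N p P"
  shows "accept_prob p P (identity_tester N p \<epsilon>) \<ge> 2 / 3"
proof -
  have "9 / 10 * (9 / 10) \<le> accept_prob p P (identity_tester N p \<epsilon>)"
    unfolding identity_tester_eq accept_prob_conj_tester
    using assms \<epsilon> m_ge
    by (intro mult_mono bucket_test_complete pair_phase_complete \<beta>_image supp) auto
  then show ?thesis by simp
qed

text \<open>If the bucket weights are off by \<epsilon> in absolute sum, the bucket test rejects;
  otherwise the discrepancy lies inside the buckets and the pair phase rejects. Either phase bounds
  the product of the acceptance probabilities.\<close>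

lemma identity_tester_sound:
  assumes D: "set_pmf D \<subseteq> {1..N}" and P: "pcond_for N D P" and far: "d_TV N D p \<ge> \<epsilon>"
  shows "accept_prob D P (identity_tester N p \<epsilon>) \<le> 1 / 3"
proof (cases "(\<Sum>j<J + 2. \<bar>pmf (map_pmf \<beta> D) j - pmf (map_pmf \<beta> p) j\<bar>) \<ge> \<epsilon>")
  case True
  have "accept_prob D P (bucket_test p \<beta> (J + 2) m (\<epsilon>\<^sup>2 / 2)) \<le> 1 / 3"
    by (rule bucket_test_sound[OF \<beta>_image[OF supp] \<beta>_image[OF D] \<epsilon> m_ge True])
  then show ?thesis
    unfolding identity_tester_eq accept_prob_conj_tester
    by (meson mult_left_le order_trans pmf_le_1 pmf_nonneg)
next
  case False
  have "(\<Sum>x\<in>bucket 0. pmf p x) \<le> \<epsilon> / 8"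
    using sum_light_bucket_le[OF \<delta>(1), where N = N and p = p] N
    unfolding bucket_def unfolding \<beta>_def by (simp add: \<delta>_def)
  then have "\<epsilon> / 12 \<le> pair_average D (pair_gap (pmf p) (pmf D))"
    using False by (intro pair_average_gap_ge[OF D _ far]) auto
  moreover have "2 / (\<epsilon> / 12) \<le> 2 ^ K"
    using ceiling_log2_bounds(1)[of "24 / \<epsilon>"] \<epsilon> by (simp add: K_def)
  ultimately have "accept_prob D P (pair_phase p \<beta> K) \<le> 1 / 3"
    using \<epsilon> by (intro pair_phase_sound[OF D P, of "\<epsilon> / 12"]) auto
  then show ?thesis
    unfolding identity_tester_eq accept_prob_conj_tester
    by (meson mult_left_le_one_le order_trans pmf_le_1 pmf_nonneg)
qed

text \<open>The bucket test costs O(sqrt(log(N/\<epsilon>)) / \<epsilon>^2) and the pair phase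
  O(log^3(1/\<epsilon>) / \<epsilon>^2), with 1 added to the logarithm of 1/\<epsilon>; both are
  bounded by the product of \<open>sqrt l\<close>, \<open>L ^ 3\<close> and 1/\<epsilon>^2.\<close>

lemma queries_le_identity_tester:
  "\<exists>q. queries_le N (identity_tester N p \<epsilon>) q \<and>
     real q \<le> 5 * 10 ^ 7 * (sqrt (ln N) / \<epsilon>\<^sup>2) * polylog_factor 3 \<epsilon> N"
proof (intro exI conjI)
  let ?q = "2 * m + K * (5 * K * 4 ^ K * (15 + 6 * K))"
  show "queries_le N (identity_tester N p \<epsilon>) ?q"
    unfolding identity_tester_eq
    by (intro queries_le_conj_tester queries_le_bucket_test queries_le_pair_phase)
  define L where "L = 1 + ln (1 / \<epsilon>)"
  define l where "l = ln (real N)"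
  have L: "1 \<le> L"
    using \<epsilon> by (simp add: L_def)
  have "ln 2 \<le> l"
    using N by (simp add: l_def)
  then have l: "1 / 2 \<le> l"
    using ln2_ge_two_thirds by linarith
  have "1 / 2 \<le> sqrt l"
    using l by (intro real_le_rsqrt) (simp add: power2_eq_square)
  have \<epsilon>2: "0 < \<epsilon>\<^sup>2" "\<epsilon>\<^sup>2 \<le> 1"
    using \<epsilon> by (auto simp: power_le_one)
  have "K * (5 * K * 4 ^ K * (15 + 6 * K)) \<le> 42301440 * (sqrt l / \<epsilon>\<^sup>2) * L ^ 3"
  proof -
    have "1 \<le> 24 / \<epsilon>"
      using \<epsilon> by simp
    note K = ceiling_log2_bounds[OF this, folded K_def]
    have "real K \<le> log 2 (48 / \<epsilon>)"
      using K(3) \<epsilon> log_mult[of 2 "24 / \<epsilon>" 2] by simp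
    \<comment> \<open>48 is rounded up to a power of 2.\<close>
    also have "\<dots> \<le> log 2 (64 / \<epsilon>)"
      using \<epsilon> by (simp add: divide_right_mono)
    also have "\<dots> = log 2 (2 ^ 6) + log 2 (1 / \<epsilon>)"
      using \<epsilon> log_mult[of 2 "2 ^ 6" "1 / \<epsilon>"] by simp
    also have "\<dots> \<le> 6 + 2 * ln (1 / \<epsilon>)"
      using log2_le[of "1 / \<epsilon>"] \<epsilon> log_pow_cancel[of 2 6] by simp
    also have "\<dots> \<le> 6 * L"
      using L by (simp add: L_def)
    finally have KL: "real K \<le> 6 * L" .
    have "(4::real) ^ K = 2 ^ K * 2 ^ K"
      by (simp add: power_mult_distrib[symmetric])
    also have "\<dots> \<le> (48 / \<epsilon>) * (48 / \<epsilon>)"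
      using K(2) \<epsilon> by (intro mult_mono) auto
    finally have K4: "(4::real) ^ K \<le> 2304 / \<epsilon>\<^sup>2"
      by (simp add: power2_eq_square)
    have "real (K * (5 * K * 4 ^ K * (15 + 6 * K))) = real K * (5 * real K * 4 ^ K * (15 + 6 * real K))"
      by simp
    also have "\<dots> \<le> (6 * L) * (5 * (6 * L) * (2304 / \<epsilon>\<^sup>2) * (51 * L))"
      using KL K4 L by (intro mult_mono) auto
    \<comment> \<open>The factor 1/2 is split off so that \<open>sqrt l\<close>, at least 1/2 for N
      \<ge> 2, can replace it.\<close>
    also have "\<dots> = 42301440 * (1 / 2 / \<epsilon>\<^sup>2) * L ^ 3"
      by (simp add: power3_eq_cube)
    also have "\<dots> \<le> 42301440 * (sqrt l / \<epsilon>\<^sup>2) * L ^ 3"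
      using \<open>1 / 2 \<le> sqrt l\<close> L
      by (intro mult_right_mono mult_left_mono divide_right_mono) auto
    finally show ?thesis .
  qed
  moreover have "2 * real m \<le> 1010 * (sqrt l / \<epsilon>\<^sup>2) * L ^ 3"
  proof -
    have "real (J + 2) \<le> log 2 (1 / \<delta>) + 3"
      using ceiling_log2_bounds(3)[OF \<delta>(2)] by (simp add: J_def)
    also have "1 / \<delta> = 2 ^ 3 * (real N * (1 / \<epsilon>))"
      by (simp add: \<delta>_def)
    also have "log 2 \<dots> = 3 + (log 2 N + log 2 (1 / \<epsilon>))"
      using N \<epsilon> log_mult[of 2 "2 ^ 3" "real N * (1 / \<epsilon>)"] log_mult[of 2 "real N" "1 / \<epsilon>"]
        log_pow_cancel[of 2 3] by simp
    also have "\<dots> + 3 \<le> 6 + 2 * l + 2 * (L - 1)"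
      using log2_le[of N] log2_le[of "1 / \<epsilon>"] N \<epsilon> by (simp add: l_def L_def)
    \<comment> \<open>The sum of logarithms is bounded by their product, as l \<ge> 1/2 and L \<ge>
      1; 25 is a perfect square that leaves the factor 5 after taking roots.\<close>
    also have "\<dots> \<le> 25 * (l * L)"
    proof -
      define z where "z = l * L"
      have "1 / 2 \<le> z" "l \<le> z" "L / 2 \<le> z"
        using mult_mono[of "1 / 2" l 1 L] mult_mono[of l l 1 L] mult_mono[of "1 / 2" l L L] l L
        by (simp_all add: z_def)
      then have "6 + 2 * l + 2 * (L - 1) \<le> 25 * z"
        by simp
      then show ?thesis
        unfolding z_def .
    qed
    finally have "sqrt (real (J + 2)) \<le> sqrt (25 * (l * L))"
      by (rule real_sqrt_le_mono)
    also have "\<dots> = 5 * (sqrt l * sqrt L)"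
      by (simp add: real_sqrt_mult)
    also have "\<dots> \<le> 5 * (sqrt l * L ^ 3)"
    proof -
      have "L \<le> L\<^sup>2"
        using L by (simp add: power2_eq_square)
      then have "sqrt L \<le> L"
        using L by (intro real_le_lsqrt) auto
      also have "L \<le> L ^ 3"
        using L self_le_power[of L 3] by simp
      finally show ?thesis
        using l by (intro mult_left_mono) auto
    qed
    finally have sB: "sqrt (real (J + 2)) \<le> 5 * (sqrt l * L ^ 3)" .
    \<comment> \<open>This absorbs the 1 lost in rounding \<open>m\<close> up, turning 100 into
      101.\<close>
    have "1 \<le> sqrt (real (J + 2)) / \<epsilon>\<^sup>2"
    proof -
      have "1 \<le> sqrt (real (J + 2))" by simp
      with \<epsilon>2 have "\<epsilon>\<^sup>2 \<le> sqrt (real (J + 2))" by linarith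
      with \<epsilon>2 show ?thesis by (simp add: field_simps)
    qed
    moreover have "real m \<le> 100 * sqrt (real (J + 2)) / \<epsilon>\<^sup>2 + 1"
    proof -
      have "0 \<le> 100 * sqrt (real (J + 2)) / \<epsilon>\<^sup>2" by simp
      then show ?thesis unfolding m_def by linarith
    qed
    ultimately have "real m \<le> 101 * (sqrt (real (J + 2)) / \<epsilon>\<^sup>2)"
      by simp
    also have "\<dots> \<le> 101 * (5 * (sqrt l * L ^ 3) / \<epsilon>\<^sup>2)"
      by (intro mult_left_mono divide_right_mono sB) auto
    finally show ?thesis by simp
  qed
  ultimately have "2 * real m + real (K * (5 * K * 4 ^ K * (15 + 6 * K))) \<le>
      1010 * (sqrt l / \<epsilon>\<^sup>2) * L ^ 3 + 42301440 * (sqrt l / \<epsilon>\<^sup>2) * L ^ 3"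
    by (rule add_mono[rotated])
  then have "real ?q \<le> 42302450 * ((sqrt l / \<epsilon>\<^sup>2) * L ^ 3)"
    by simp
  also have "\<dots> \<le> 5 * 10 ^ 7 * ((sqrt l / \<epsilon>\<^sup>2) * L ^ 3)"
    using l L by (intro mult_right_mono) auto
  also have "\<dots> = 5 * 10 ^ 7 * (sqrt l / \<epsilon>\<^sup>2) * L ^ 3"
    by (rule mult.assoc[symmetric])
  also have "\<dots> \<le> 5 * 10 ^ 7 * (sqrt l / \<epsilon>\<^sup>2) * polylog_factor 3 \<epsilon> N"
  proof -
    have "1 \<le> 1 + ln (1 + l)"
      using l by simp
    then have "L ^ 3 * 1 \<le> L ^ 3 * (1 + ln (1 + l)) ^ 3"
      using L by (intro mult_left_mono one_le_power) auto
    then have "L ^ 3 \<le> polylog_factor 3 \<epsilon> N"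
      by (simp add: polylog_factor_def L_def l_def)
    then show ?thesis
      using l by (intro mult_left_mono) auto
  qed
  finally show "real ?q \<le> 5 * 10 ^ 7 * (sqrt (ln N) / \<epsilon>\<^sup>2) * polylog_factor 3 \<epsilon> N"
    unfolding l_def .
qed

end

theorem theorem1p4:
  shows "\<exists>(C::real) (c::nat).
    \<forall>(N::nat) (Dstar::nat pmf). distribution_on N Dstar \<longrightarrow>
      (\<exists>A::real \<Rightarrow> tester. \<forall>\<epsilon>::real. 0 < \<epsilon> \<and> \<epsilon> < 1 \<longrightarrow>
         legal_queries N (A \<epsilon>) \<and>
         (\<exists>q::nat. queries_le N (A \<epsilon>) q \<and>
            real q \<le> C * (sqrt (ln (real N)) / \<epsilon>\<^sup>2) * polylog_factor c \<epsilon> N) \<and>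
         (\<forall>(D::nat pmf) (P::nat \<Rightarrow> nat \<Rightarrow> nat pmf).
            distribution_on N D \<and> pcond_for N D P \<longrightarrow>
              (D = Dstar \<longrightarrow> pmf (run D P (A \<epsilon>)) Accept \<ge> 2 / 3) \<and>
              (d_TV N D Dstar \<ge> \<epsilon> \<longrightarrow> pmf (run D P (A \<epsilon>)) Reject \<ge> 2 / 3)))"
proof (intro exI allI impI)
  fix N p \<epsilon>
  assume "distribution_on N p" and "0 < \<epsilon> \<and> \<epsilon> < (1::real)"
  then have supp: "set_pmf p \<subseteq> {1..N}" and \<epsilon>: "0 < \<epsilon>" "\<epsilon> < 1"
    by (auto simp: distribution_on_def)
  let ?A = "identity_tester N p \<epsilon>"
  show "legal_queries N ?A \<and>
    (\<exists>q. queries_le N ?A q \<and> real q \<le> 5 * 10 ^ 7 * (sqrt (ln N) / \<epsilon>\<^sup>2) * polylog_factor 3 \<epsilon> N) \<and>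
    (\<forall>D P. distribution_on N D \<and> pcond_for N D P \<longrightarrow>
       (D = p \<longrightarrow> pmf (run D P ?A) Accept \<ge> 2 / 3) \<and>
       (d_TV N D p \<ge> \<epsilon> \<longrightarrow> pmf (run D P ?A) Reject \<ge> 2 / 3))"
  proof (cases "2 \<le> N")
    case True
    note facts = legal_queries_identity_tester[OF True supp \<epsilon>]
      queries_le_identity_tester[OF True supp \<epsilon>] identity_tester_complete[OF True supp \<epsilon>]
      identity_tester_sound[OF True supp \<epsilon>]
    show ?thesis
      using facts unfolding pmf_Reject distribution_on_def by fastforce
  next
    \<comment> \<open>On a single point there is only one distribution, and accepting without a
      query meets the bound, which is 0 as ln 1 = 0.\<close>
    case False
    moreover have "N \<noteq> 0"
      using supp set_pmf_not_empty[of p] by auto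
    ultimately have N: "N = 1"
      by simp
    have "d_TV N D p = 0" if "distribution_on N D" for D
    proof -
      have "pmf D 1 = 1" "pmf p 1 = 1"
        using that supp N sum_pmf_eq_1[of "{1}" D] sum_pmf_eq_1[of "{1}" p]
        by (simp_all add: distribution_on_def)
      then show ?thesis
        by (simp add: d_TV_def N)
    qed
    moreover have "?A = Output Accept"
      using N by (simp add: identity_tester_def)
    ultimately show ?thesis
      using \<epsilon> N by (auto intro: exI[of _ 0])
  qed
qed

end
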